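(* Let $f$ be a central function in $\mathrm{Lip}_{\alpha}(SU(2))$ for some $\alpha\in(0,1)$. Then: (a) $S_Nf(x)\to f(x)$ uniformly on the complement in $SU(2)$ of any open set containing $\{e,-e\}$, where $e$ is the identity matrix; (b) $S_Nf(x)\to f(x)$ uniformly on $SU(2)$ if the sequences $\{S_Nf(e)\}_{N=0}^{\infty}$ and $\{S_Nf(-e)\}_{N=0}^{\infty}$ both converge.
   Context: $SU(2)$ is the group of $2\times 2$ complex unitary matrices of determinant $1$, equipped with the metric $d(x,y)=\sqrt{\tfrac12\mathrm{tr}((x-y)(x-y)^* )}$. For $0<\alpha<1$, $\mathrm{Lip}_{\alpha}(SU(2))$ is the set of real functions $f$ on $SU(2)$ for which there is $M\ge 0$ with $|f(x)-f(y)|\le M d(x,y)^{\alpha}$ for all $x,y$. A function $f$ is central if $f(yxy^{-1})=f(x)$ for all $x,y\in SU(2)$. Let $\mu$ be normalized Haar measure on $SU(2)$. For $x\in SU(2)$ with eigenvalues $e^{\pm i\theta}$, $\theta\in[0,\pi]$, let $\chi_n(x)=\frac{\sin((n+1)\theta)}{\sin\theta}$ (by continuity at $\theta=0,\pi$), $\mathbf{D}_N=\sum_{n=0}^N(n+1)\chi_n$, and for $f\in L^1(SU(2))$, $S_Nf(x)=\int_{SU(2)} f(xy^{-1})\mathbf{D}_N(y)\,d\mu(y)$. *)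

theory Defs
  imports "HOL-Analysis.Analysis"
begin

type_synonym cmat2 = "complex^2^2"

definition ctrans :: "cmat2 \<Rightarrow> cmat2" where
  "ctrans x = (\<chi> i j. cnj (x $ j $ i))"

definition SU2 :: "cmat2 set" where
  "SU2 = {x. x ** ctrans x = mat 1 \<and> ctrans x ** x = mat 1 \<and> det x = 1}"

definition su2_dist :: "cmat2 \<Rightarrow> cmat2 \<Rightarrow> real" where
  "su2_dist x y = sqrt (Re (trace ((x - y) ** ctrans (x - y))) / 2)"

definition Lip :: "real \<Rightarrow> (cmat2 \<Rightarrow> real) set" where
  "Lip \<alpha> = {f. \<exists>M\<ge>0. \<forall>x\<in>SU2. \<forall>y\<in>SU2. \<bar>f x - f y\<bar> \<le> M * su2_dist x y powr \<alpha>}"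

definition central :: "(cmat2 \<Rightarrow> real) \<Rightarrow> bool" where
  "central f \<longleftrightarrow> (\<forall>x\<in>SU2. \<forall>y\<in>SU2. f (y ** x ** ctrans y) = f x)"

text \<open>Normalized Haar measure on SU(2): a Borel probability measure on SU(2)
  invariant under left translations (unique by the uniqueness of Haar measure).\<close>
definition haar_SU2 :: "cmat2 measure \<Rightarrow> bool" where
  "haar_SU2 \<mu> \<longleftrightarrow> emeasure \<mu> (space \<mu>) = 1 \<and> sets \<mu> = sets (restrict_space borel SU2) \<and>
     (\<forall>g\<in>SU2. \<forall>A\<in>sets \<mu>. emeasure \<mu> ((\<lambda>x. g ** x) ` A) = emeasure \<mu> A)"

definition su2_angle :: "cmat2 \<Rightarrow> real" where
  "su2_angle x = (THE \<theta>. 0 \<le> \<theta> \<and> \<theta> \<le> pi \<and> det (x - mat (cis \<theta>)) = 0)"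

text \<open>chi_n(x) = sin((n+1)theta)/sin theta, extended by continuity at theta = 0, pi.\<close>
definition chi :: "nat \<Rightarrow> cmat2 \<Rightarrow> real" where
  "chi n x = (let \<theta> = su2_angle x in
      if \<theta> = 0 then real (n + 1)
      else if \<theta> = pi then (-1) ^ n * real (n + 1)
      else sin (real (n + 1) * \<theta>) / sin \<theta>)"

definition DN :: "nat \<Rightarrow> cmat2 \<Rightarrow> real" where
  "DN N y = (\<Sum>n\<le>N. real (n + 1) * chi n y)"

text \<open>S_N f(x) = integral of f(x y^{-1}) D_N(y) dmu(y); on SU(2), y^{-1} = y^*.\<close>
definition SN :: "cmat2 measure \<Rightarrow> nat \<Rightarrow> (cmat2 \<Rightarrow> real) \<Rightarrow> cmat2 \<Rightarrow> real" where
  "SN \<mu> N f x = (\<integral>y. f (x ** ctrans y) * DN N y \<partial>\<mu>)"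

end

theory Submission
  imports Defs "HOL-Real_Asymp.Real_Asymp"
begin

text \<open>A central \<open>f\<close> is determined by \<open>F \<theta> = f (diag (e^{i\<theta>}, e^{-i\<theta>}))\<close>, an even, periodic,
  Hoelder continuous function with cosine coefficients \<open>a n\<close>. The law of the diagonal entry under Haar
  measure is uniform on the unit disk, which gives \<open>S\<^sub>N f = \<Sum>n\<le>N. (a n - a (n + 2)) \<chi>\<^sub>n\<close>. Since
  \<open>\<chi>\<^sub>n - \<chi>\<^sub>n\<^sub>-\<^sub>2 = 2 cos n\<theta>\<close>, summation by parts turns this into the \<open>N\<close>-th cosine partial sum of \<open>F\<close>
  minus \<open>a (N + 1) \<chi>\<^sub>N\<^sub>-\<^sub>1 + a (N + 2) \<chi>\<^sub>N\<close>. The partial sums converge uniformly by Dini's test. Away from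
  \<open>\<plusminus>e\<close> the characters are bounded, so the remainder tends to 0 with \<open>a n\<close>. In general
  \<open>\<bar>\<chi>\<^sub>n\<bar> \<le> n + 1\<close>, and convergence at both \<open>e\<close> and \<open>-e\<close> forces \<open>n a n \<longlonglongrightarrow> 0\<close>, because the series of
  \<open>a n\<close> and of \<open>(-1)^n a n\<close> converge.\<close>

section \<open>Uniform convergence of cosine series\<close>

text \<open>Haar measure enters only as a left invariant Borel probability measure, so the disk law
  has to be extracted from invariance, without coordinates on the group or Weyl's integration
  formula. Elements of SU(2) are points of the three-sphere; left translation carries the first real
  coordinate s to any unit linear form, so the d-th moment of a linear form is its norm to the power
  d times one number \<open>mom d\<close>. Joint moments follow by polarisation, and the equation of
  the sphere fixes \<open>mom d\<close> for even d. The convolution with a character becomes an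
  average over vertical chords of the disk, which is elementary because the derivative of T_n is n
  U_{n-1}; the outcome is a Funk-Hecke formula on the three-sphere. Moments reach polynomials only,
  so continuous functions come in through Stone-Weierstrass. Characters are treated throughout as
  Chebyshev polynomials in half the trace, which removes the exceptional angles 0 and pi.\<close>

lemma half_le_sin:
  assumes "0 \<le> x" "x \<le> pi / 2"
  shows "x / 2 \<le> sin x"
proof (cases "x \<le> pi / 3")
  case True
  show ?thesis
  proof (cases "x = 0")
    case False
    then have "0 < x" using assms by simp
    then have "\<exists>z. 0 < z \<and> z < x \<and> (sin x - x / 2) - (sin 0 - 0 / 2) = (x - 0) * (cos z - 1 / 2)"
      by (rule MVT2) (auto intro!: derivative_eq_intros)
    then obtain z where z: "0 < z" "z < x" "sin x - x / 2 = x * (cos z - 1 / 2)" by auto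
    have "cos z \<ge> 1 / 2"
      using cos_monotone_0_pi_le[of z "pi / 3"] z True by (simp add: cos_60)
    then have "0 \<le> x * (cos z - 1 / 2)" using assms by simp
    then show ?thesis using z by simp
  qed simp
next
  case False
  \<comment> \<open>Beyond \<open>pi / 3\<close> the sine is at least sqrt 3 / 2, hence at least
    0.85, while x / 2 is at most pi / 4 < 0.8.\<close>
  have "sin (pi / 3) \<le> sin x"
    using False assms by (intro sin_monotone_2pi_le) auto
  moreover have "pi < 3.2" using pi_approx by simp
  moreover have "sqrt 3 \<ge> 1.7"
    by (rule real_le_rsqrt) (simp add: power2_eq_square)
  ultimately show ?thesis
    using assms \<open>pi < 3.2\<close> unfolding sin_60 by linarith
qed

lemma integral_periodic_shift:
  fixes P :: "real \<Rightarrow> real"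
  assumes cont: "continuous_on UNIV P" and per: "\<And>x. P (x + p) = P x" and "0 \<le> p"
  shows "integral {a..a + p} P = integral {b..b + p} P"
proof -
  have int: "P integrable_on {c..d}" for c d
    using cont continuous_on_subset integrable_continuous_real by blast
  have *: "integral {a..a + p} P = integral {b..b + p} P" if "a \<le> b" for a b
  proof -
    have "integral {a..a + p} P + integral {a + p..b + p} P = integral {a..b} P + integral {b..b + p} P"
      using that assms(3) by (simp add: int Henstock_Kurzweil_Integration.integral_combine)
    moreover have "integral {a + p..b + p} P = integral {a..b} P"
      using integral_shift_real_ivl[of "a + p" p "b + p" P] by (simp add: per)
    ultimately show ?thesis by simp
  qed
  show ?thesis
    using *[of a b] *[of b a] by linarith
qed

lemma abs_integral_le_bound:
  fixes f :: "real \<Rightarrow> real"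
  assumes "continuous_on {a..b} f" "\<And>x. x \<in> {a..b} \<Longrightarrow> \<bar>f x\<bar> \<le> B" "a \<le> b"
  shows "\<bar>integral {a..b} f\<bar> \<le> B * (b - a)"
  using integral_bound[of a b f B] assms by auto

text \<open>Translating by half a period \<open>\<tau>\<close> of the sine changes its sign, so twice the integral is an
  integral of \<open>h u - h (u + \<tau>)\<close> up to two boundary pieces of length \<open>\<tau>\<close>.\<close>

lemma abs_integral_sin_le:
  fixes h :: "real \<Rightarrow> real"
  assumes h: "continuous_on {a..b} h" and "a \<le> b" and "0 < l"
    and B: "\<And>x. x \<in> {a..b} \<Longrightarrow> \<bar>h x\<bar> \<le> B"
    and e: "\<And>x y. x \<in> {a..b} \<Longrightarrow> y \<in> {a..b} \<Longrightarrow> \<bar>x - y\<bar> \<le> pi / l \<Longrightarrow> \<bar>h x - h y\<bar> \<le> e"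
  shows "\<bar>integral {a..b} (\<lambda>x. h x * sin (l * x))\<bar> \<le> ((b - a) * e + 2 * (pi / l) * B) / 2"
proof -
  define \<tau> where "\<tau> = pi / l"
  \<comment> \<open>Clamping to \<open>{a..b}\<close> extends \<open>h\<close> constantly, so that
    translated integrals make sense; it is 1-Lipschitz, so both bounds on \<open>h\<close> survive
    on the whole line.\<close>
  define H where "H x = h (max a (min b x))" for x
  have \<tau>: "0 < \<tau>" using \<open>0 < l\<close> by (simp add: \<tau>_def)
  have clamp: "max a (min b x) \<in> {a..b}" for x using \<open>a \<le> b\<close> by auto
  have contH: "continuous_on UNIV H"
    unfolding H_def
    by (rule continuous_on_compose2[OF h]) (auto intro!: continuous_intros simp: \<open>a \<le> b\<close>)
  define K where "K u = H (u + \<tau>) * sin (l * u)" for u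
  have contH': "continuous_on S (\<lambda>u. H (u + c))" for S c
    by (rule continuous_on_compose2[OF contH]) (auto intro!: continuous_intros)
  have contK: "continuous_on S K" for S
    unfolding K_def by (intro continuous_intros contH')
  have contHs: "continuous_on S (\<lambda>u. H u * sin (l * u))" for S
    using contH'[of S 0] by (auto intro!: continuous_intros)
  have intK: "K integrable_on {c..d}" for c d
    by (intro integrable_continuous_real contK)
  have HB: "\<bar>H x\<bar> \<le> B" for x unfolding H_def using clamp B by blast
  have KB: "\<bar>K x\<bar> \<le> B" for x
    using mult_mono[OF HB[of "x + \<tau>"] abs_sin_le_one[of "l * x"]] order_trans[OF abs_ge_zero HB]
    by (simp add: K_def abs_mult)
  have He: "\<bar>H u - H (u + \<tau>)\<bar> \<le> e" for u
    unfolding H_def using \<tau> \<open>a \<le> b\<close> by (intro e clamp) (auto simp: \<tau>_def[symmetric])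
  let ?I = "integral {a..b} (\<lambda>x. h x * sin (l * x))"
  have I1: "?I = integral {a..b} (\<lambda>x. H x * sin (l * x))"
    by (rule integral_cong) (auto simp: H_def)
  also have "\<dots> = integral {a - \<tau>..b - \<tau>} (\<lambda>x. H (x + \<tau>) * sin (l * (x + \<tau>)))"
    by (rule integral_shift_real_ivl[symmetric])
  also have "\<dots> = integral {a - \<tau>..b - \<tau>} (\<lambda>x. - K x)"
    using \<open>0 < l\<close> by (intro integral_cong) (simp add: K_def \<tau>_def distrib_left sin_add)
  also have "\<dots> = - integral {a - \<tau>..b - \<tau>} K" by simp
  finally have I2: "?I = - integral {a - \<tau>..b - \<tau>} K" .
  have "integral {a - \<tau>..a} K + integral {a..b} K = integral {a - \<tau>..b} K"
    using \<tau> \<open>a \<le> b\<close> intK by (intro Henstock_Kurzweil_Integration.integral_combine) auto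
  moreover have "integral {a - \<tau>..b - \<tau>} K + integral {b - \<tau>..b} K = integral {a - \<tau>..b} K"
    using \<tau> \<open>a \<le> b\<close> intK by (intro Henstock_Kurzweil_Integration.integral_combine) auto
  moreover have "integral {a..b} (\<lambda>x. H x * sin (l * x)) - integral {a..b} K
      = integral {a..b} (\<lambda>x. H x * sin (l * x) - K x)"
    by (intro Henstock_Kurzweil_Integration.integral_diff[symmetric] intK integrable_continuous_real contHs)
  ultimately have "2 * ?I = integral {a..b} (\<lambda>x. H x * sin (l * x) - K x)
      - integral {a - \<tau>..a} K + integral {b - \<tau>..b} K"
    using I1 I2 by linarith
  moreover have "\<bar>integral {a..b} (\<lambda>x. H x * sin (l * x) - K x)\<bar> \<le> e * (b - a)"
  proof (rule abs_integral_le_bound)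
    fix x
    have "\<bar>H x - H (x + \<tau>)\<bar> * \<bar>sin (l * x)\<bar> \<le> e * 1"
      using He[of x] by (intro mult_mono) auto
    then show "\<bar>H x * sin (l * x) - K x\<bar> \<le> e"
      by (simp add: K_def abs_mult[symmetric] algebra_simps)
  qed (intro continuous_on_diff contHs contK, fact)
  moreover have "\<bar>integral {a - \<tau>..a} K\<bar> \<le> B * \<tau>"
    using abs_integral_le_bound[OF contK KB, of "a - \<tau>" a] \<tau> by simp
  moreover have "\<bar>integral {b - \<tau>..b} K\<bar> \<le> B * \<tau>"
    using abs_integral_le_bound[OF contK KB, of "b - \<tau>" b] \<tau> by simp
  ultimately have "2 * \<bar>?I\<bar> \<le> e * (b - a) + 2 * (B * \<tau>)" by linarith
  then show ?thesis by (simp add: \<tau>_def mult_ac)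
qed

section \<open>The Dirichlet kernel and cosine partial sums\<close>

definition dirichlet :: "nat \<Rightarrow> real \<Rightarrow> real" where
  "dirichlet N t = 1 / 2 + (\<Sum>n=1..N. cos (real n * t))"

lemma continuous_on_dirichlet [continuous_intros]:
  fixes f :: "real \<Rightarrow> real"
  shows "continuous_on S f \<Longrightarrow> continuous_on S (\<lambda>x. dirichlet N (f x))"
  unfolding dirichlet_def by (intro continuous_intros)

lemma dirichlet_minus [simp]: "dirichlet N (- t) = dirichlet N t"
  by (simp add: dirichlet_def)

lemma dirichlet_periodic: "dirichlet N (t + 2 * pi) = dirichlet N t"
proof -
  have "cos (real n * (t + 2 * pi)) = cos (real n * t)" for n
    using cos.plus_of_nat[of "real n * t" n] by (simp add: distrib_left mult_ac)
  then show ?thesis by (simp add: dirichlet_def)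
qed

text \<open>Each 2 sin(t/2) cos(nt) is a difference of sines at neighbouring half-integer
  frequencies, so the sum telescopes. The product form needs no exception where the sine
  vanishes.\<close>

lemma dirichlet_closed_form: "2 * sin (t / 2) * dirichlet N t = sin ((real N + 1 / 2) * t)"
proof (induction N)
  case (Suc N)
  have "2 * sin (t / 2) * cos ((real N + 1) * t) =
      sin ((real N + 1) * t + t / 2) - sin ((real N + 1) * t - t / 2)"
    by (simp add: sin_add sin_diff)
  then show ?case
    using Suc by (simp add: dirichlet_def algebra_simps)
qed (simp add: dirichlet_def)

lemma integral_cos_nat: "integral {0..pi} (\<lambda>t. cos (real n * t)) = (if n = 0 then pi else 0)"
proof (cases "n = 0")
  case False
  have "((\<lambda>t. cos (real n * t)) has_integral (sin (real n * pi) / real n - sin (real n * 0) / real n)) {0..pi}"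
    using False by (intro fundamental_theorem_of_calculus)
      (auto intro!: derivative_eq_intros simp: has_real_derivative_iff_has_vector_derivative[symmetric])
  then show ?thesis using False by (simp add: integral_unique)
qed simp

lemma integral_dirichlet: "integral {0..pi} (dirichlet N) = pi / 2"
proof -
  have "integral {0..pi} (dirichlet N) = integral {0..pi} (\<lambda>t. 1 / 2)
      + integral {0..pi} (\<lambda>t. \<Sum>n=1..N. cos (real n * t))"
    unfolding dirichlet_def[abs_def]
    by (intro Henstock_Kurzweil_Integration.integral_add integrable_continuous_real continuous_intros)
  also have "integral {0..pi} (\<lambda>t. \<Sum>n=1..N. cos (real n * t)) = (\<Sum>n=1..N. integral {0..pi} (\<lambda>t. cos (real n * t)))"
    by (intro Henstock_Kurzweil_Integration.integral_sum integrable_continuous_real continuous_intros) auto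
  also have "\<dots> = 0" by (intro sum.neutral) (auto simp: integral_cos_nat)
  finally show ?thesis by simp
qed

text \<open>The bound does not depend on \<open>N\<close>, and against a factor
  \<open>t powr \<alpha>\<close> it stays integrable at 0: this controls the part of the integral
  near 0.\<close>

lemma abs_dirichlet_le:
  assumes "0 < t" "t \<le> pi"
  shows "\<bar>dirichlet N t\<bar> \<le> 2 / t"
proof -
  have s: "t / 4 \<le> sin (t / 2)" using half_le_sin[of "t / 2"] assms by simp
  have "2 * sin (t / 2) * \<bar>dirichlet N t\<bar> = \<bar>sin ((real N + 1 / 2) * t)\<bar>"
    unfolding dirichlet_closed_form[symmetric] using s assms by (simp add: abs_mult)
  then have "2 * sin (t / 2) * \<bar>dirichlet N t\<bar> \<le> 1" by simp
  moreover have "t / 2 * \<bar>dirichlet N t\<bar> \<le> 2 * sin (t / 2) * \<bar>dirichlet N t\<bar>"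
    using s by (intro mult_right_mono) auto
  ultimately show ?thesis using assms by (simp add: field_simps)
qed

text \<open>For an even function of period 2 pi this is the exponential Fourier coefficient. Hence
  the factor 2 in \<open>cos_sum\<close>, and hence a n - a (n + 2) is the coefficient of the n-th
  character without further constants.\<close>

definition cos_coeff :: "(real \<Rightarrow> real) \<Rightarrow> nat \<Rightarrow> real" where
  "cos_coeff F n = integral {0..pi} (\<lambda>t. F t * cos (real n * t)) / pi"

definition cos_sum :: "(real \<Rightarrow> real) \<Rightarrow> nat \<Rightarrow> real \<Rightarrow> real" where
  "cos_sum F N t = cos_coeff F 0 + 2 * (\<Sum>n=1..N. cos_coeff F n * cos (real n * t))"

context
  fixes F :: "real \<Rightarrow> real"
  assumes contF: "continuous_on UNIV F" and F_even: "\<And>x. F (- x) = F x"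
    and F_per: "\<And>x. F (x + 2 * pi) = F x"
begin

lemma continuous_on_F:
  "continuous_on S f \<Longrightarrow> continuous_on S (\<lambda>x. F (f x))"
  by (rule continuous_on_compose2[OF contF]) auto

text \<open>Product-to-sum formulas produce the kernel at t - \<theta> and t + \<theta>. Evenness
  makes the second value the reflection of the first, so the half-period integral unfolds to a full
  period, where periodicity absorbs the shift by \<theta>; folding back gives the right-hand
  side.\<close>

lemma cos_sum_eq_integral:
  "cos_sum F N \<theta> = integral {0..pi} (\<lambda>\<phi>. (F (\<theta> + \<phi>) + F (\<theta> - \<phi>)) * dirichlet N \<phi>) / pi"
proof -
  note [continuous_intros] = continuous_on_F
  define P where "P u = F (u + \<theta>) * dirichlet N u" for u
  have contP: "continuous_on S P" for S
    unfolding P_def by (intro continuous_intros)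
  have intP: "P integrable_on {a..b}" for a b by (intro integrable_continuous_real contP)
  have split: "integral {-pi..pi} f = integral {0..pi} (\<lambda>x. f x + f (- x))"
    if "continuous_on UNIV f" for f :: "real \<Rightarrow> real"
  proof -
    have c: "continuous_on S f" "continuous_on S (\<lambda>x. f (- x))" for S
      using that continuous_on_subset apply blast
      by (rule continuous_on_compose2[OF that]) (auto intro!: continuous_intros)
    have "integral {-pi..pi} f = integral {-pi..0} f + integral {0..pi} f"
      by (rule Henstock_Kurzweil_Integration.integral_combine[symmetric])
        (auto intro!: integrable_continuous_real c)
    also have "integral {-pi..0} f = integral {0..pi} (\<lambda>x. f (- x))"
      using Henstock_Kurzweil_Integration.integral_reflect_real[of pi 0 "\<lambda>x. f (- x)"] by simp
    finally show ?thesis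
      by (subst Henstock_Kurzweil_Integration.integral_add)
        (auto intro!: integrable_continuous_real c)
  qed
  have "pi * cos_sum F N \<theta> = integral {0..pi} (\<lambda>t. F t * cos (real 0 * t)) +
      (\<Sum>n=1..N. integral {0..pi} (\<lambda>t. F t * cos (real n * t)) * (2 * cos (real n * \<theta>)))"
    by (simp add: cos_sum_def cos_coeff_def distrib_left sum_distrib_left mult_ac)
  also have "\<dots> = integral {0..pi} (\<lambda>t. F t) +
      (\<Sum>n=1..N. integral {0..pi} (\<lambda>t. F t * cos (real n * t) * (2 * cos (real n * \<theta>))))"
    by simp
  also have "(\<Sum>n=1..N. integral {0..pi} (\<lambda>t. F t * cos (real n * t) * (2 * cos (real n * \<theta>))))
     = integral {0..pi} (\<lambda>t. \<Sum>n=1..N. F t * cos (real n * t) * (2 * cos (real n * \<theta>)))"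
    by (intro Henstock_Kurzweil_Integration.integral_sum[symmetric] integrable_continuous_real continuous_intros) auto
  also have "integral {0..pi} (\<lambda>t. F t) + \<dots> =
      integral {0..pi} (\<lambda>t. F t + (\<Sum>n=1..N. F t * cos (real n * t) * (2 * cos (real n * \<theta>))))"
    by (intro Henstock_Kurzweil_Integration.integral_add[symmetric] integrable_continuous_real continuous_intros)
  also have "\<dots> = integral {0..pi} (\<lambda>t. P (t - \<theta>) + P (- t - \<theta>))"
  proof (rule integral_cong)
    fix t
    have *: "2 * cos (real n * t) * cos (real n * \<theta>) = cos (real n * (t - \<theta>)) + cos (real n * (t + \<theta>))" for n
      by (simp add: right_diff_distrib distrib_left cos_add cos_diff)
    have "F t + (\<Sum>n=1..N. F t * cos (real n * t) * (2 * cos (real n * \<theta>)))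
      = F t * (1 + (\<Sum>n=1..N. 2 * cos (real n * t) * cos (real n * \<theta>)))"
      by (simp add: distrib_left sum_distrib_left mult_ac)
    also have "\<dots> = F t * (dirichlet N (t - \<theta>) + dirichlet N (t + \<theta>))"
      by (simp only: * sum.distrib) (simp add: dirichlet_def)
    also have "dirichlet N (t + \<theta>) = dirichlet N (- t - \<theta>)"
      using dirichlet_minus[of N "t + \<theta>"] by simp
    finally show "F t + (\<Sum>n=1..N. F t * cos (real n * t) * (2 * cos (real n * \<theta>))) =
        P (t - \<theta>) + P (- t - \<theta>)"
      by (simp add: P_def F_even distrib_left)
  qed
  also have "\<dots> = integral {-pi..pi} (\<lambda>t. P (t + (- \<theta>)))"
    by (subst split) (auto intro!: continuous_intros simp: P_def)
  also have "\<dots> = integral {-pi-\<theta>..(-pi-\<theta>)+2*pi} P"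
    using integral_shift_real_ivl[of "-pi-\<theta>" "-\<theta>" "pi-\<theta>" P] by (simp add: algebra_simps)
  also have "\<dots> = integral {-pi..-pi+2*pi} P"
    by (rule integral_periodic_shift[OF contP])
      (use F_per[of "_ + \<theta>"] in \<open>auto simp: P_def dirichlet_periodic add_ac\<close>)
  also have "\<dots> = integral {-pi..pi} P" by simp
  also have "\<dots> = integral {0..pi} (\<lambda>\<phi>. (F (\<theta> + \<phi>) + F (\<theta> - \<phi>)) * dirichlet N \<phi>)"
    by (subst split[OF contP]) (simp add: P_def algebra_simps)
  finally show ?thesis by (simp add: field_simps)
qed

lemma cos_sum_minus_eq_integral:
  "cos_sum F N \<theta> - F \<theta> = integral {0..pi} (\<lambda>\<phi>. (F (\<theta> + \<phi>) + F (\<theta> - \<phi>) - 2 * F \<theta>) * dirichlet N \<phi>) / pi"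
proof -
  note [continuous_intros] = continuous_on_F
  have "integral {0..pi} (\<lambda>\<phi>. (F (\<theta> + \<phi>) + F (\<theta> - \<phi>) - 2 * F \<theta>) * dirichlet N \<phi>)
     = integral {0..pi} (\<lambda>\<phi>. (F (\<theta> + \<phi>) + F (\<theta> - \<phi>)) * dirichlet N \<phi> - 2 * F \<theta> * dirichlet N \<phi>)"
    by (simp add: left_diff_distrib)
  also have "\<dots> = integral {0..pi} (\<lambda>\<phi>. (F (\<theta> + \<phi>) + F (\<theta> - \<phi>)) * dirichlet N \<phi>) -
      integral {0..pi} (\<lambda>\<phi>. 2 * F \<theta> * dirichlet N \<phi>)"
    by (intro Henstock_Kurzweil_Integration.integral_diff integrable_continuous_real continuous_intros)
  also have "integral {0..pi} (\<lambda>\<phi>. 2 * F \<theta> * dirichlet N \<phi>) = F \<theta> * pi"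
    by (simp add: integral_dirichlet)
  finally show ?thesis
    by (simp add: cos_sum_eq_integral diff_divide_distrib)
qed

end

section \<open>Uniform convergence under a Hoelder condition\<close>

lemma continuous_on_holder:
  fixes F :: "real \<Rightarrow> real"
  assumes "0 < \<alpha>" and holder: "\<And>x y. \<bar>F x - F y\<bar> \<le> M * \<bar>x - y\<bar> powr \<alpha>"
  shows "continuous_on UNIV F"
proof -
  have "(F \<longlongrightarrow> F x) (at x)" for x
  proof (rule Lim_null_comparison[THEN LIM_zero_cancel])
    show "\<forall>\<^sub>F y in at x. norm (F y - F x) \<le> M * \<bar>y - x\<bar> powr \<alpha>"
      using holder by (simp add: always_eventually)
    have "((\<lambda>y. M * \<bar>y - x\<bar> powr \<alpha>) \<longlongrightarrow> M * \<bar>x - x\<bar> powr \<alpha>) (at x)"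
      using assms(1) by (intro tendsto_intros) (auto intro: always_eventually)
    then show "((\<lambda>y. M * \<bar>y - x\<bar> powr \<alpha>) \<longlongrightarrow> 0) (at x)" using assms(1) by simp
  qed
  then show ?thesis by (simp add: continuous_on_def)
qed

text \<open>Dini's argument with all constants free of \<theta>. Near 0 the second difference of
  \<open>F\<close> beats the singularity of the kernel for every \<open>N\<close> at once; beyond d
  the kernel is a fixed continuous factor times a sine of frequency N + 1/2, and
  \<open>abs_integral_sin_le\<close> acts as a quantitative Riemann-Lebesgue lemma.\<close>

theorem uniform_limit_cos_sum:
  fixes F :: "real \<Rightarrow> real"
  assumes "0 < \<alpha>" and holder: "\<And>x y. \<bar>F x - F y\<bar> \<le> M * \<bar>x - y\<bar> powr \<alpha>"
    and F_even: "\<And>x. F (- x) = F x" and F_per: "\<And>x. F (x + 2 * pi) = F x"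
  shows "uniform_limit UNIV (cos_sum F) F sequentially"
proof (rule uniform_limitI)
  fix e :: real assume "0 < e"
  have contF: "continuous_on UNIV F" by (rule continuous_on_holder[OF assms(1,2)])
  have contF': "continuous_on S (\<lambda>x. F (f x))" if "continuous_on S f" for S and f :: "real \<Rightarrow> real"
    by (rule continuous_on_compose2[OF contF that]) auto
  have M: "0 \<le> M" using holder[of 0 1] by auto
  define \<Delta> where "\<Delta> \<theta> \<phi> = F (\<theta> + \<phi>) + F (\<theta> - \<phi>) - 2 * F \<theta>" for \<theta> \<phi>
  have \<Delta>0: "\<bar>\<Delta> \<theta> \<phi>\<bar> \<le> 2 * M * \<bar>\<phi>\<bar> powr \<alpha>" for \<theta> \<phi>
    using holder[of "\<theta> + \<phi>" \<theta>] holder[of "\<theta> - \<phi>" \<theta>] by (simp add: \<Delta>_def)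
  have \<Delta>1: "\<bar>\<Delta> \<theta> x - \<Delta> \<theta> y\<bar> \<le> 2 * M * \<bar>x - y\<bar> powr \<alpha>" for \<theta> x y
    using holder[of "\<theta> + x" "\<theta> + y"] holder[of "\<theta> - x" "\<theta> - y"]
    by (simp add: \<Delta>_def abs_minus_commute[of x y])
  have cont\<Delta>: "continuous_on S (\<lambda>\<phi>. \<Delta> \<theta> \<phi>)" for S \<theta>
    unfolding \<Delta>_def
    by (intro continuous_on_add continuous_on_diff continuous_on_const continuous_on_id contF')

  \<comment> \<open>\<open>4 * M * (d powr \<alpha> / \<alpha>)\<close> is the integral over
    \<open>{0..d}\<close> of the bound 2 M x^\<alpha> * (2/x) for the integrand.\<close>
  have "((\<lambda>d. 4 * M * (d powr \<alpha> / \<alpha>)) \<longlongrightarrow> 4 * M * (0 powr \<alpha> / \<alpha>)) (at_right 0)"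
    using assms(1) by (intro tendsto_intros) (auto simp: eventually_at_filter)
  then have "\<forall>\<^sub>F d in at_right 0. 4 * M * (d powr \<alpha> / \<alpha>) < e / 2"
    using \<open>0 < e\<close> assms(1) by (intro order_tendstoD) auto
  moreover have "\<forall>\<^sub>F d :: real in at_right 0. 0 < d \<and> d < pi"
    using eventually_at_right_real[of 0 pi] by (auto elim: eventually_mono)
  ultimately have "\<forall>\<^sub>F d in at_right 0. 4 * M * (d powr \<alpha> / \<alpha>) < e / 2 \<and> 0 < d \<and> d < pi"
    by eventually_elim auto
  then obtain d where d: "0 < d" "d < pi" "4 * M * (d powr \<alpha> / \<alpha>) < e / 2"
    using eventually_happens trivial_limit_at_right_real by blast

  have inner: "\<bar>integral {0..d} (\<lambda>\<phi>. \<Delta> \<theta> \<phi> * dirichlet N \<phi>)\<bar> < e / 2" for \<theta> N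
  proof -
    have pw: "((\<lambda>x. x powr (\<alpha> - 1)) has_integral (d powr \<alpha> / \<alpha>)) {0..d}"
      using has_integral_powr_from_0[of "\<alpha> - 1" d] assms(1) d by simp
    have "norm (integral {0..d} (\<lambda>\<phi>. \<Delta> \<theta> \<phi> * dirichlet N \<phi>)) \<le> integral {0..d} (\<lambda>x. 4 * M * x powr (\<alpha> - 1))"
    proof (rule integral_norm_bound_integral)
      fix x assume x: "x \<in> {0..d}"
      show "norm (\<Delta> \<theta> x * dirichlet N x) \<le> 4 * M * x powr (\<alpha> - 1)"
      \<comment> \<open>At 0 the second difference vanishes, and
        \<open>0 powr (\<alpha> - 1)\<close> is 0 by convention, so the pointwise bound holds there
        too.\<close>
      proof (cases "x = 0")
        case False
        with x d have x': "0 < x" "x \<le> pi" by auto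
        have "norm (\<Delta> \<theta> x * dirichlet N x) \<le> (2 * M * \<bar>x\<bar> powr \<alpha>) * (2 / x)"
          unfolding real_norm_def abs_mult using M x'
          by (intro mult_mono \<Delta>0 abs_dirichlet_le) auto
        also have "\<dots> = 4 * M * x powr (\<alpha> - 1)"
          using x' by (simp add: powr_diff)
        finally show ?thesis .
      qed (simp add: \<Delta>_def)
    next
      show "(\<lambda>x. 4 * M * x powr (\<alpha> - 1)) integrable_on {0..d}"
        using pw by (intro integrable_on_mult_right) (auto simp: integrable_on_def)
    qed (intro integrable_continuous_real continuous_on_mult continuous_on_dirichlet continuous_on_id cont\<Delta>)
    also have "\<dots> = 4 * M * (d powr \<alpha> / \<alpha>)"
      using pw by (simp add: integral_unique)
    finally show ?thesis using d by simp
  qed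

  \<comment> \<open>By the closed form, the kernel is \<open>k \<phi>\<close> times the sine of (N +
    1/2) \<phi>; \<open>k\<close> does not depend on \<open>N\<close> and is bounded by 2/d on
    \<open>{d..pi}\<close>.\<close>
  define k where "k \<phi> = 1 / (2 * sin (\<phi> / 2))" for \<phi> :: real
  have spos: "sin (x / 2) > 0" if "x \<in> {d..pi}" for x
    using that d by (intro sin_gt_zero) auto
  have "2 * sin (x / 2) \<noteq> 0" if "x \<in> {d..pi}" for x
    using spos[OF that] by simp
  then have contk: "continuous_on {d..pi} k"
    unfolding k_def
    by (intro continuous_on_divide continuous_on_mult continuous_on_sin continuous_on_const
        continuous_on_id ballI) auto
  have kB: "\<bar>k x\<bar> \<le> 2 / d" if "x \<in> {d..pi}" for x
  proof -
    have "d / 2 \<le> 2 * sin (x / 2)" using half_le_sin[of "x / 2"] that d by simp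
    then have "1 / (2 * sin (x / 2)) \<le> 1 / (d / 2)"
      using d spos[OF that] by (intro divide_left_mono mult_pos_pos) auto
    then show ?thesis using d spos[OF that] by (simp add: k_def)
  qed
  define A where "A = 2 * M * pi powr \<alpha>"
  define B where "B = A * (2 / d)"
  have A: "0 \<le> A" and B: "0 \<le> B" using M d by (simp_all add: A_def B_def)
  have \<Delta>A: "\<bar>\<Delta> \<theta> x\<bar> \<le> A" if "x \<in> {d..pi}" for x \<theta>
  proof -
    have "\<bar>x\<bar> powr \<alpha> \<le> pi powr \<alpha>" using that d assms(1) by (intro powr_mono2) auto
    then show ?thesis using \<Delta>0[of \<theta> x] M unfolding A_def
      by (meson mult_left_mono order_trans mult_nonneg_nonneg zero_le_numeral)
  qed
  \<comment> \<open>\<open>\<eta>\<close> is the oscillation allowed to \<Delta> * k over half a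
    period pi / l, one half for each factor. With the boundary pieces also below e / 4, the outer
    integral stays below e / 2.\<close>
  obtain \<eta> where \<eta>: "0 < \<eta>" "pi * \<eta> < e / 4"
    using \<open>0 < e\<close> by (intro that[of "e / (8 * pi)"]) (auto simp: field_simps)
  have ev1: "\<forall>\<^sub>F N in sequentially. 2 * M * (pi / (real N + 1 / 2)) powr \<alpha> * (2 / d) < \<eta> / 2"
  proof (rule order_tendstoD)
    have "(\<lambda>N. pi / (real N + 1 / 2)) \<longlonglongrightarrow> 0" by real_asymp
    then have "(\<lambda>N. 2 * M * (pi / (real N + 1 / 2)) powr \<alpha> * (2 / d)) \<longlonglongrightarrow> 2 * M * 0 powr \<alpha> * (2 / d)"
      using assms(1) by (intro tendsto_intros) (auto intro!: always_eventually)
    then show "(\<lambda>N. 2 * M * (pi / (real N + 1 / 2)) powr \<alpha> * (2 / d)) \<longlonglongrightarrow> 0" by simp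
  qed (use \<eta> in auto)
  obtain r where r: "0 < r"
    "\<And>x y. x \<in> {d..pi} \<Longrightarrow> y \<in> {d..pi} \<Longrightarrow> \<bar>x - y\<bar> < r \<Longrightarrow> A * \<bar>k x - k y\<bar> \<le> \<eta> / 2"
  proof -
    have "uniformly_continuous_on {d..pi} k"
      using contk by (rule compact_uniformly_continuous) auto
    \<comment> \<open>The denominator has \<open>A + 1\<close> instead of \<open>A\<close> because
      \<open>A\<close> is 0 when \<open>M\<close> is 0.\<close>
    then obtain r where "0 < r"
      "\<And>x y. x \<in> {d..pi} \<Longrightarrow> y \<in> {d..pi} \<Longrightarrow> dist y x < r \<Longrightarrow> dist (k y) (k x) < \<eta> / (2 * (A + 1))"
      using A \<eta> unfolding uniformly_continuous_on_def by (metis add_nonneg_pos divide_pos_pos mult_pos_pos zero_less_numeral zero_less_one)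
    moreover have "A * z \<le> \<eta> / 2" if "z < \<eta> / (2 * (A + 1))" "0 \<le> z" for z
    proof -
      have "A * z \<le> (A + 1) * z" using that by (simp add: distrib_right)
      also have "\<dots> \<le> \<eta> / 2" using that A by (simp add: field_simps)
      finally show ?thesis .
    qed
    ultimately show thesis using that[of r] by (auto simp: dist_real_def abs_minus_commute)
  qed
  have ev2: "\<forall>\<^sub>F N in sequentially. pi / (real N + 1 / 2) < r"
    using r(1) by real_asymp
  have ev3: "\<forall>\<^sub>F N in sequentially. 2 * (pi / (real N + 1 / 2)) * B < e / 4"
  proof (rule order_tendstoD)
    show "(\<lambda>N. 2 * (pi / (real N + 1 / 2)) * B) \<longlonglongrightarrow> 0" by real_asymp
  qed (use \<open>0 < e\<close> in auto)
  show "\<forall>\<^sub>F N in sequentially. \<forall>\<theta>\<in>UNIV. dist (cos_sum F N \<theta>) (F \<theta>) < e"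
  proof (rule eventually_mono[OF eventually_conj[OF ev1 eventually_conj[OF ev2 ev3]]])
    fix N
    assume elim: "2 * M * (pi / (real N + 1 / 2)) powr \<alpha> * (2 / d) < \<eta> / 2 \<and>
      pi / (real N + 1 / 2) < r \<and> 2 * (pi / (real N + 1 / 2)) * B < e / 4"
    have "dist (cos_sum F N \<theta>) (F \<theta>) < e" for \<theta>
    proof -
      define l where "l = real N + 1 / 2"
      have outer: "\<bar>integral {d..pi} (\<lambda>\<phi>. (\<Delta> \<theta> \<phi> * k \<phi>) * sin (l * \<phi>))\<bar> \<le> ((pi - d) * \<eta> + 2 * (pi / l) * B) / 2"
      proof (rule abs_integral_sin_le)
        show "continuous_on {d..pi} (\<lambda>\<phi>. \<Delta> \<theta> \<phi> * k \<phi>)"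
          by (intro continuous_on_mult cont\<Delta> contk)
        show "\<bar>\<Delta> \<theta> x * k x\<bar> \<le> B" if "x \<in> {d..pi}" for x
          unfolding B_def abs_mult using that A by (intro mult_mono \<Delta>A kB) auto
        show "\<bar>\<Delta> \<theta> x * k x - \<Delta> \<theta> y * k y\<bar> \<le> \<eta>"
          if xy: "x \<in> {d..pi}" "y \<in> {d..pi}" "\<bar>x - y\<bar> \<le> pi / l" for x y
        proof -
          have "\<Delta> \<theta> x * k x - \<Delta> \<theta> y * k y = (\<Delta> \<theta> x - \<Delta> \<theta> y) * k x + \<Delta> \<theta> y * (k x - k y)"
            by (simp add: algebra_simps)
          moreover have "\<bar>(\<Delta> \<theta> x - \<Delta> \<theta> y) * k x\<bar> \<le> 2 * M * (pi / l) powr \<alpha> * (2 / d)"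
          proof -
            have "\<bar>x - y\<bar> powr \<alpha> \<le> (pi / l) powr \<alpha>"
              using xy assms(1) by (intro powr_mono2) auto
            then have "\<bar>\<Delta> \<theta> x - \<Delta> \<theta> y\<bar> \<le> 2 * M * (pi / l) powr \<alpha>"
              using \<Delta>1[of \<theta> x y] M by (meson mult_left_mono order_trans mult_nonneg_nonneg zero_le_numeral)
            then show ?thesis
              unfolding abs_mult using xy M by (intro mult_mono kB) auto
          qed
          moreover have "\<bar>\<Delta> \<theta> y * (k x - k y)\<bar> \<le> \<eta> / 2"
          proof -
            have "\<bar>\<Delta> \<theta> y * (k x - k y)\<bar> \<le> A * \<bar>k x - k y\<bar>"
              unfolding abs_mult using xy by (intro mult_right_mono \<Delta>A) auto
            also have "\<dots> \<le> \<eta> / 2" using xy elim by (intro r(2)) (auto simp: l_def)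
            finally show ?thesis .
          qed
          ultimately show ?thesis using elim[folded l_def] by linarith
        qed
      qed (use d in \<open>auto simp: l_def\<close>)
      have "(pi - d) * \<eta> \<le> pi * \<eta>" using d \<eta> by (intro mult_right_mono) auto
      then have "\<bar>integral {d..pi} (\<lambda>\<phi>. (\<Delta> \<theta> \<phi> * k \<phi>) * sin (l * \<phi>))\<bar> \<le> (pi * \<eta> + 2 * (pi / l) * B) / 2"
        by (intro order_trans[OF outer] divide_right_mono add_right_mono) simp_all
      moreover have "2 * (pi / l) * B < e / 4" using elim[folded l_def] by blast
      ultimately have outer': "\<bar>integral {d..pi} (\<lambda>\<phi>. (\<Delta> \<theta> \<phi> * k \<phi>) * sin (l * \<phi>))\<bar> < e / 2"
        using \<eta> \<open>0 < e\<close> by simp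
      have "integral {d..pi} (\<lambda>\<phi>. \<Delta> \<theta> \<phi> * dirichlet N \<phi>) = integral {d..pi} (\<lambda>\<phi>. (\<Delta> \<theta> \<phi> * k \<phi>) * sin (l * \<phi>))"
        using spos by (intro integral_cong) (simp add: k_def l_def dirichlet_closed_form[symmetric] less_imp_neq[symmetric])
      moreover have "integral {0..d} (\<lambda>\<phi>. \<Delta> \<theta> \<phi> * dirichlet N \<phi>) + integral {d..pi} (\<lambda>\<phi>. \<Delta> \<theta> \<phi> * dirichlet N \<phi>)
         = integral {0..pi} (\<lambda>\<phi>. \<Delta> \<theta> \<phi> * dirichlet N \<phi>)"
        using d by (intro Henstock_Kurzweil_Integration.integral_combine integrable_continuous_real
              continuous_on_mult continuous_on_dirichlet continuous_on_id cont\<Delta>) auto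
      ultimately have "\<bar>integral {0..pi} (\<lambda>\<phi>. \<Delta> \<theta> \<phi> * dirichlet N \<phi>)\<bar> < e"
        using inner[of \<theta> N] outer' by linarith
      moreover have "e \<le> e * pi" using \<open>0 < e\<close> pi_gt3 by simp
      ultimately show ?thesis
        unfolding dist_real_def cos_sum_minus_eq_integral[of F, OF contF F_even F_per] \<Delta>_def[symmetric]
        by (simp add: field_simps)
    qed
    then show "\<forall>\<theta>\<in>UNIV. dist (cos_sum F N \<theta>) (F \<theta>) < e" by blast
  qed
qed

section \<open>Chebyshev polynomials\<close>

fun cheb_t :: "nat \<Rightarrow> real \<Rightarrow> real" where
  "cheb_t 0 x = 1"
| "cheb_t (Suc 0) x = x"
| "cheb_t (Suc (Suc n)) x = 2 * x * cheb_t (Suc n) x - cheb_t n x"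

text \<open>Indexed so that \<open>cheb_u n\<close> has degree \<open>n - 1\<close>; the usual \<open>U\<^sub>n\<close> is \<open>cheb_u (Suc n)\<close>.\<close>

fun cheb_u :: "nat \<Rightarrow> real \<Rightarrow> real" where
  "cheb_u 0 x = 0"
| "cheb_u (Suc 0) x = 1"
| "cheb_u (Suc (Suc n)) x = 2 * x * cheb_u (Suc n) x - cheb_u n x"

lemma cos_Suc_Suc: "cos (real (Suc (Suc n)) * t) = 2 * cos t * cos (real (Suc n) * t) - cos (real n * t)"
proof -
  have "real (Suc (Suc n)) * t = real (Suc n) * t + t" "real n * t = real (Suc n) * t - t"
    by (simp_all add: algebra_simps)
  then show ?thesis by (simp only: cos_add cos_diff) simp
qed

lemma sin_Suc_Suc: "sin (real (Suc (Suc n)) * t) = 2 * cos t * sin (real (Suc n) * t) - sin (real n * t)"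
proof -
  have "real (Suc (Suc n)) * t = real (Suc n) * t + t" "real n * t = real (Suc n) * t - t"
    by (simp_all add: algebra_simps)
  then show ?thesis by (simp only: sin_add sin_diff) simp
qed

lemma cheb_t_cos: "cheb_t n (cos t) = cos (real n * t)"
  by (induction n "cos t" rule: cheb_t.induct) (simp_all only: cheb_t.simps cos_Suc_Suc, simp_all)

lemma cheb_u_cos: "cheb_u n (cos t) * sin t = sin (real n * t)"
proof (induction n "cos t" rule: cheb_u.induct)
  case (3 n)
  have "cheb_u (Suc (Suc n)) (cos t) * sin t =
      2 * cos t * (cheb_u (Suc n) (cos t) * sin t) - cheb_u n (cos t) * sin t"
    by (simp add: algebra_simps)
  then show ?case by (simp only: 3 sin_Suc_Suc)
qed simp_all

lemma cheb_u_1: "cheb_u n 1 = real n"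
  by (induction n "1::real" rule: cheb_u.induct) auto

lemma cheb_u_minus: "cheb_u n (- x) = (- 1) ^ Suc n * cheb_u n x"
  by (induction n x rule: cheb_u.induct) (auto simp: algebra_simps)

lemma cheb_u_minus_cheb_u: "cheb_u (Suc (Suc n)) x - cheb_u n x = 2 * cheb_t (Suc n) x"
proof (induction n x rule: cheb_t.induct)
  case (3 n x)
  have "cheb_u (Suc (Suc (Suc (Suc n)))) x - cheb_u (Suc (Suc n)) x =
      2 * x * (cheb_u (Suc (Suc (Suc n))) x - cheb_u (Suc n) x) - (cheb_u (Suc (Suc n)) x - cheb_u n x)"
    by (simp only: cheb_u.simps) (simp add: algebra_simps)
  then show ?case by (simp only: 3) simp
qed auto

lemma cheb_u_Suc: "cheb_u (Suc n) x = x * cheb_u n x + cheb_t n x"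
proof (induction n x rule: cheb_t.induct)
  case (3 n x)
  have "cheb_u (Suc (Suc (Suc n))) x = 2 * x * cheb_u (Suc (Suc n)) x - cheb_u (Suc n) x"
    "cheb_u (Suc (Suc n)) x = 2 * x * cheb_u (Suc n) x - cheb_u n x"
    "cheb_t (Suc (Suc n)) x = 2 * x * cheb_t (Suc n) x - cheb_t n x"
    by simp_all
  with 3 show ?case by algebra
qed auto

text \<open>Makes \<open>cheb_t\<close> the antiderivative for the chord integrals in
  \<open>integral_cheb_u\<close>.\<close>

lemma DERIV_cheb_t: "(cheb_t n has_real_derivative real n * cheb_u n x) (at x)"
proof (induction n x rule: cheb_t.induct)
  case (3 n x)
  have "((\<lambda>x. 2 * x * cheb_t (Suc n) x - cheb_t n x) has_real_derivative
      (2 * cheb_t (Suc n) x + 2 * x * (real (Suc n) * cheb_u (Suc n) x) - real n * cheb_u n x)) (at x)"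
    using 3 by (auto intro!: derivative_eq_intros simp del: of_nat_Suc)
  moreover have "2 * cheb_t (Suc n) x + 2 * x * (real (Suc n) * cheb_u (Suc n) x) - real n * cheb_u n x
      = real (Suc (Suc n)) * cheb_u (Suc (Suc n)) x"
    using cheb_u_minus_cheb_u[of n x] by (simp add: algebra_simps)
  ultimately show ?case by simp
qed auto

text \<open>Induction along \<open>cheb_u_Suc\<close> avoids dividing by the sine, so the end
  points, where the bound is attained, are included.\<close>

lemma abs_cheb_u_le:
  assumes "\<bar>x\<bar> \<le> 1"
  shows "\<bar>cheb_u n x\<bar> \<le> real n"
proof (induction n)
  case (Suc n)
  have "cheb_t n x = cos (real n * arccos x)"
    using cheb_t_cos[of n "arccos x"] assms by simp
  then have "\<bar>cheb_t n x\<bar> \<le> 1" by simp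
  moreover have "\<bar>x\<bar> * \<bar>cheb_u n x\<bar> \<le> 1 * real n"
    using assms Suc by (intro mult_mono) auto
  ultimately show ?case
    unfolding cheb_u_Suc using abs_triangle_ineq[of "x * cheb_u n x" "cheb_t n x"] by (simp add: abs_mult)
qed simp

lemma real_polynomial_function_cheb_u: "real_polynomial_function (cheb_u n)"
proof (induction n rule: induct_nat_012)
  case (ge2 n)
  have "real_polynomial_function (\<lambda>x::real. x)"
    by (rule real_polynomial_function.intros(1)) (rule bounded_linear_ident)
  then show ?case
    using ge2 by (auto intro!: real_polynomial_function.intros(2-) real_polynomial_function_diff)
qed (simp_all add: real_polynomial_function.intros(2))

lemma continuous_on_cheb_u [continuous_intros]:
  fixes f :: "'a :: topological_space \<Rightarrow> real"
  assumes "continuous_on S f"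
  shows "continuous_on S (\<lambda>x. cheb_u n (f x))"
  by (rule continuous_on_compose2[OF _ assms, of UNIV])
    (auto intro!: continuous_on_polymonial_function simp: real_polynomial_function_eq[symmetric] real_polynomial_function_cheb_u)

text \<open>As t runs over the chord, the argument runs from cos(\<theta> + \<phi>) to cos(\<theta>
  - \<phi>), where the antiderivative is a cosine. Divided by the chord length 2 sin \<phi>, this is
  the product formula for characters: the mean of chi_{n-1} over a product of two conjugacy classes
  is the product of its values divided by n.\<close>

lemma integral_cheb_u:
  assumes "n > 0" "0 \<le> \<phi>" "\<phi> \<le> pi"
  shows "integral {- sin \<phi>..sin \<phi>} (\<lambda>t. cheb_u n (cos \<theta> * cos \<phi> + sin \<theta> * t)) =
    2 * sin (real n * \<phi>) * cheb_u n (cos \<theta>) / real n"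
proof (cases "sin \<theta> = 0")
  case False
  have s: "0 \<le> sin \<phi>" using assms by (simp add: sin_ge_zero)
  let ?G = "\<lambda>t. cheb_t n (cos \<theta> * cos \<phi> + sin \<theta> * t) / (real n * sin \<theta>)"
  have "((\<lambda>t. cheb_u n (cos \<theta> * cos \<phi> + sin \<theta> * t)) has_integral (?G (sin \<phi>) - ?G (- sin \<phi>))) {- sin \<phi>..sin \<phi>}"
    using assms s False by (intro fundamental_theorem_of_calculus)
      (auto intro!: derivative_eq_intros DERIV_chain2[OF DERIV_cheb_t]
            simp: has_real_derivative_iff_has_vector_derivative[symmetric])
  moreover have "?G (sin \<phi>) = cos (real n * (\<theta> - \<phi>)) / (real n * sin \<theta>)"
    unfolding cheb_t_cos[symmetric] by (simp add: cos_diff)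
  moreover have "?G (- sin \<phi>) = cos (real n * (\<theta> + \<phi>)) / (real n * sin \<theta>)"
    unfolding cheb_t_cos[symmetric] by (simp add: cos_add)
  moreover have "cos (real n * (\<theta> - \<phi>)) - cos (real n * (\<theta> + \<phi>)) = 2 * sin (real n * \<phi>) * (cheb_u n (cos \<theta>) * sin \<theta>)"
    unfolding cheb_u_cos by (simp add: cos_diff cos_add algebra_simps)
  ultimately show ?thesis
    using assms False by (simp add: integral_unique diff_divide_distrib[symmetric])
next
  \<comment> \<open>The antiderivative above divides by sin \<theta>. Here the integrand is constant
    in t, and \<open>cheb_u n (cos \<theta>)\<close> is a value at 1 or -1.\<close>
  case True
  have s: "0 \<le> sin \<phi>" using assms by (simp add: sin_ge_zero)
  have "cos \<theta> = 1 \<or> cos \<theta> = - 1"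
    using sin_cos_squared_add[of \<theta>] True by (simp add: power2_eq_1_iff)
  moreover have "2 * sin \<phi> * cheb_u n (cos \<phi>) = 2 * sin (real n * \<phi>)"
    by (simp add: cheb_u_cos[symmetric])
  ultimately show ?thesis
    using True assms(1) s by (auto simp: cheb_u_minus cheb_u_1)
qed

section \<open>The group SU(2)\<close>

text \<open>Matrix model of the quaternions. The arguments are not normalised, so differences of
  group elements have this form as well.\<close>

definition su2 :: "complex \<Rightarrow> complex \<Rightarrow> cmat2" where
  "su2 p q = (\<chi> i j. if i = 1 then (if j = 1 then p else q) else (if j = 1 then - cnj q else cnj p))"

lemma su2_nth [simp]:
  "su2 p q $ 1 $ 1 = p" "su2 p q $ 1 $ 2 = q" "su2 p q $ 2 $ 1 = - cnj q" "su2 p q $ 2 $ 2 = cnj p"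
  by (simp_all add: su2_def)

lemma cmat2_eq_iff: "(x :: cmat2) = y \<longleftrightarrow>
    x $ 1 $ 1 = y $ 1 $ 1 \<and> x $ 1 $ 2 = y $ 1 $ 2 \<and> x $ 2 $ 1 = y $ 2 $ 1 \<and> x $ 2 $ 2 = y $ 2 $ 2"
  by (auto simp: vec_eq_iff forall_2)

lemma cmat2_mult_nth: "((x :: cmat2) ** y) $ i $ j = x $ i $ 1 * y $ 1 $ j + x $ i $ 2 * y $ 2 $ j"
  by (simp add: matrix_matrix_mult_def sum_2)

lemma ctrans_nth [simp]: "ctrans x $ i $ j = cnj (x $ j $ i)"
  by (simp add: ctrans_def)

lemma mat_2_nth: "(mat k :: cmat2) $ i $ j = (if i = j then k else 0)"
  by (simp add: mat_def)

lemma su2_mult: "su2 p q ** su2 r s = su2 (p * r - q * cnj s) (p * s + q * cnj r)"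
  by (simp add: cmat2_eq_iff cmat2_mult_nth algebra_simps)

lemma ctrans_su2: "ctrans (su2 p q) = su2 (cnj p) (- q)"
  by (simp add: cmat2_eq_iff)

lemma mat_1_eq_su2: "mat 1 = su2 1 0"
  by (simp add: cmat2_eq_iff mat_2_nth)

lemma minus_su2: "- su2 p q = su2 (- p) (- q)"
  by (simp add: cmat2_eq_iff)

lemma su2_in_SU2_iff: "su2 p q \<in> SU2 \<longleftrightarrow> (cmod p)\<^sup>2 + (cmod q)\<^sup>2 = 1"
proof -
  define N where "N = (cmod p)\<^sup>2 + (cmod q)\<^sup>2"
  have N: "complex_of_real N = p * cnj p + q * cnj q"
    unfolding N_def of_real_add complex_norm_square by simp
  have "det (su2 p q) = complex_of_real N"
    by (simp add: det_2 N)
  moreover have "p * cnj p + q * cnj q = complex_of_real N" "cnj p * p + q * cnj q = complex_of_real N"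
    by (simp_all add: N mult.commute)
  ultimately show ?thesis
    unfolding SU2_def mem_Collect_eq ctrans_su2 su2_mult N_def[symmetric]
    by (auto simp: mat_1_eq_su2 mult.commute)
qed

text \<open>The adjoint inverts x, and so does the adjugate because the determinant is 1; comparing
  the two expresses the second row by the first.\<close>

lemma SU2_cases:
  assumes "x \<in> SU2"
  obtains p q where "x = su2 p q" "(cmod p)\<^sup>2 + (cmod q)\<^sup>2 = 1"
proof -
  define a b c d where "a = x $ 1 $ 1" and "b = x $ 1 $ 2" and "c = x $ 2 $ 1" and "d = x $ 2 $ 2"
  have "ctrans x ** x = mat 1" "det x = 1" using assms by (auto simp: SU2_def)
  then have 1: "cnj a * a + cnj c * c = 1" and 2: "cnj a * b + cnj c * d = 0" and 3: "a * d - b * c = 1"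
    by (auto simp: cmat2_eq_iff cmat2_mult_nth mat_2_nth det_2 a_def b_def c_def d_def)
  have "d = cnj a"
    using 1 2 3 by algebra
  moreover have "cnj c = - b"
    using 1 2 3 by algebra
  then have "c = - cnj b"
    by (metis complex_cnj_cnj complex_cnj_minus)
  ultimately have "x = su2 a b"
    by (simp add: cmat2_eq_iff a_def b_def c_def d_def)
  with assms show thesis
    using that su2_in_SU2_iff by blast
qed

lemma SU2_mult: "x \<in> SU2 \<Longrightarrow> y \<in> SU2 \<Longrightarrow> x ** y \<in> SU2"
proof -
  assume "x \<in> SU2" "y \<in> SU2"
  then obtain p q r s where *: "x = su2 p q" "(cmod p)\<^sup>2 + (cmod q)\<^sup>2 = 1"
    "y = su2 r s" "(cmod r)\<^sup>2 + (cmod s)\<^sup>2 = 1" by (metis SU2_cases)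
  have "complex_of_real ((cmod (p * r - q * cnj s))\<^sup>2 + (cmod (p * s + q * cnj r))\<^sup>2) =
    complex_of_real (((cmod p)\<^sup>2 + (cmod q)\<^sup>2) * ((cmod r)\<^sup>2 + (cmod s)\<^sup>2))"
    unfolding of_real_mult of_real_add complex_norm_square by (simp add: algebra_simps)
  then show ?thesis using * unfolding of_real_eq_iff by (simp add: su2_mult su2_in_SU2_iff)
qed

lemma ctrans_SU2: "x \<in> SU2 \<Longrightarrow> ctrans x \<in> SU2"
  by (erule SU2_cases) (simp add: ctrans_su2 su2_in_SU2_iff)

lemma ctrans_mult: "ctrans (x ** y) = ctrans y ** ctrans x"
  by (simp add: cmat2_eq_iff cmat2_mult_nth mult.commute)

text \<open>Used twice: it makes continuous functions Haar integrable, and it gives sin^2 of the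
  angle a positive minimum away from \<open>mat 1\<close> and \<open>- mat 1\<close>.\<close>

lemma compact_SU2: "compact SU2"
proof -
  have "continuous_on UNIV (\<lambda>x::cmat2. x ** ctrans x)" "continuous_on UNIV (\<lambda>x::cmat2. ctrans x ** x)"
     "continuous_on UNIV (\<lambda>x::cmat2. det x)"
    unfolding matrix_matrix_mult_def ctrans_def det_2
    by (auto intro!: continuous_intros)
  then have "closed ({x. x ** ctrans x = mat 1} \<inter> {x. ctrans x ** x = mat 1} \<inter> {x. det x = (1::complex)})"
    by (intro closed_Int closed_Collect_eq continuous_on_const)
  moreover have "SU2 = {x. x ** ctrans x = mat 1} \<inter> {x. ctrans x ** x = mat 1} \<inter> {x. det x = (1::complex)}"
    by (auto simp: SU2_def)
  ultimately have "closed SU2" by simp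
  moreover have "bounded SU2"
  proof (rule boundedI)
    fix x assume "x \<in> SU2"
    then obtain p q where x: "x = su2 p q" "(cmod p)\<^sup>2 + (cmod q)\<^sup>2 = 1" by (rule SU2_cases)
    then have "(cmod p)\<^sup>2 \<le> 1" "(cmod q)\<^sup>2 \<le> 1" using zero_le_power2 by (smt (verit))+
    then have "cmod p \<le> 1" "cmod q \<le> 1"
      using abs_square_le_1[of "cmod p"] abs_square_le_1[of "cmod q"] by auto
    then have "norm (x $ 1 $ 1) + norm (x $ 1 $ 2) + norm (x $ 2 $ 1) + norm (x $ 2 $ 2) \<le> 4"
      by (simp add: x(1))
    moreover have "norm x \<le> norm (x $ 1) + norm (x $ 2)" "norm (x $ i) \<le> norm (x $ i $ 1) + norm (x $ i $ 2)" for i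
      unfolding norm_vec_def[of x] norm_vec_def[of "x $ i"] L2_set_def sum_2 by (auto intro: sqrt_sum_squares_le_sum)
    ultimately show "norm x \<le> 4" by (smt (verit))
  qed
  ultimately show ?thesis by (simp add: compact_eq_bounded_closed)
qed

lemma su2_angle_su2:
  assumes "su2 p q \<in> SU2"
  shows "su2_angle (su2 p q) = arccos (Re p)"
proof -
  have pq: "(cmod p)\<^sup>2 + (cmod q)\<^sup>2 = 1" using assms by (simp add: su2_in_SU2_iff)
  then have "(Re p)\<^sup>2 \<le> 1" by (simp add: cmod_power2) (smt (verit) zero_le_power2)
  then have s: "\<bar>Re p\<bar> \<le> 1" by (simp add: abs_square_le_1)
  \<comment> \<open>On the unit circle the characteristic polynomial z^2 - 2 Re p z + 1 is z times
    (z + cnj z - 2 Re p), so its zeros depend on the cosine alone, which is injective on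
    \<open>{0..pi}\<close>.\<close>
  have det: "det (su2 p q - mat (cis t)) = cis t * complex_of_real (2 * cos t - 2 * Re p)" for t
  proof -
    have "det (su2 p q - mat (cis t)) = complex_of_real ((cmod p)\<^sup>2 + (cmod q)\<^sup>2) - (p + cnj p) * cis t + cis t * cis t"
      unfolding of_real_add complex_norm_square by (simp add: det_2 mat_2_nth algebra_simps)
    also have "\<dots> = cis t * cis (- t) - (p + cnj p) * cis t + cis t * cis t"
      unfolding pq by (simp add: cis_mult)
    also have "\<dots> = cis t * ((cis t + cnj (cis t)) - (p + cnj p))"
      by (simp add: algebra_simps cis_cnj)
    also have "\<dots> = cis t * complex_of_real (2 * cos t - 2 * Re p)"
      unfolding complex_add_cnj by simp
    finally show ?thesis .
  qed
  have "det (su2 p q - mat (cis t)) = 0 \<longleftrightarrow> cos t = Re p" for t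
    unfolding det by simp
  then show ?thesis
    unfolding su2_angle_def using s
    by (intro the_equality) (auto intro: arccos_lbound arccos_ubound dest: arccos_cos)
qed

lemma abs_Re_SU2_le: "x \<in> SU2 \<Longrightarrow> \<bar>Re (x $ 1 $ 1)\<bar> \<le> 1"
proof (erule SU2_cases)
  fix p q assume x: "x = su2 p q" "(cmod p)\<^sup>2 + (cmod q)\<^sup>2 = 1"
  then have "(Re p)\<^sup>2 \<le> 1" by (simp add: cmod_power2) (smt (verit) zero_le_power2)
  with x show "\<bar>Re (x $ 1 $ 1)\<bar> \<le> 1" by (simp add: abs_square_le_1)
qed

text \<open>Absorbs the three cases of \<open>chi\<close> in one polynomial in half the trace, which
  makes continuity and moments available.\<close>

lemma chi_eq_cheb_u:
  assumes "x \<in> SU2"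
  shows "chi n x = cheb_u (Suc n) (Re (x $ 1 $ 1))"
proof -
  define t where "t = su2_angle x"
  obtain p q where x: "x = su2 p q" by (metis SU2_cases assms)
  then have t: "t = arccos (Re (x $ 1 $ 1))"
    using assms by (simp add: t_def su2_angle_su2)
  then have c: "Re (x $ 1 $ 1) = cos t" and b: "0 \<le> t" "t \<le> pi"
    using abs_Re_SU2_le[OF assms] arccos_lbound arccos_ubound by (auto simp: abs_le_iff)
  have "sin t \<noteq> 0" if "t \<noteq> 0" "t \<noteq> pi"
    using sin_gt_zero[of t] that b by simp
  then show ?thesis
    using cheb_u_cos[of "Suc n" t]
    unfolding c chi_def Let_def t_def[symmetric]
    by (auto simp: cheb_u_1 cheb_u_minus divide_eq_eq simp del: cheb_u.simps of_nat_Suc)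
qed

section \<open>Moments of Haar measure\<close>

definition wallis :: "nat \<Rightarrow> nat \<Rightarrow> real" where
  "wallis i j = integral {0..pi} (\<lambda>t. cos t ^ i * sin t ^ j)"

lemma wallis_integrable: "(\<lambda>t. cos t ^ i * sin t ^ j) integrable_on {0..pi::real}"
  by (intro integrable_continuous_real continuous_intros)

text \<open>The difference of the two sides is the integral of the derivative of cos^(i+1)
  sin^(j+1), which vanishes at both ends.\<close>

lemma wallis_recursion: "real (j + 1) * wallis (i + 2) j = real (i + 1) * wallis i (j + 2)"
proof -
  let ?f = "\<lambda>t. real (j + 1) * (cos t ^ (i + 2) * sin t ^ j) - real (i + 1) * (cos t ^ i * sin t ^ (j + 2))"
  have "(?f has_integral (cos pi ^ (i + 1) * sin pi ^ (j + 1) - cos 0 ^ (i + 1) * sin 0 ^ (j + 1))) {0..pi}"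
  proof (rule fundamental_theorem_of_calculus)
    fix t :: real
    have "((\<lambda>t. cos t ^ Suc i * sin t ^ Suc j) has_real_derivative
        (1 + real i) * (- sin t * cos t ^ i) * sin t ^ Suc j + (1 + real j) * (cos t * sin t ^ j) * cos t ^ Suc i) (at t within {0..pi})"
      by (rule DERIV_mult[OF DERIV_power_Suc[OF DERIV_cos] DERIV_power_Suc[OF DERIV_sin], THEN has_field_derivative_at_within])
    then show "((\<lambda>t. cos t ^ (i + 1) * sin t ^ (j + 1)) has_vector_derivative ?f t) (at t within {0..pi})"
      by (simp add: has_real_derivative_iff_has_vector_derivative[symmetric] algebra_simps)
  qed simp
  then have "integral {0..pi} ?f = 0" by (simp add: integral_unique)
  moreover have "integral {0..pi} ?f = real (j + 1) * wallis (i + 2) j - real (i + 1) * wallis i (j + 2)"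
    unfolding wallis_def
    by (subst Henstock_Kurzweil_Integration.integral_diff)
      (auto intro!: integrable_continuous_real continuous_intros simp del: of_nat_add)
  ultimately show ?thesis by simp
qed

lemma wallis_split: "wallis i j = wallis (i + 2) j + wallis i (j + 2)"
proof -
  have "wallis (i + 2) j + wallis i (j + 2) = integral {0..pi} (\<lambda>t. cos t ^ (i + 2) * sin t ^ j + cos t ^ i * sin t ^ (j + 2))"
    unfolding wallis_def by (intro Henstock_Kurzweil_Integration.integral_add[symmetric] wallis_integrable)
  also have "\<dots> = wallis i j"
    unfolding wallis_def
  proof (rule integral_cong)
    fix t :: real
    have "cos t ^ (i + 2) * sin t ^ j + cos t ^ i * sin t ^ (j + 2) = cos t ^ i * sin t ^ j * ((cos t)\<^sup>2 + (sin t)\<^sup>2)"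
      by (simp only: power_add distrib_left mult_ac)
    then show "cos t ^ (i + 2) * sin t ^ j + cos t ^ i * sin t ^ (j + 2) = cos t ^ i * sin t ^ j" by simp
  qed
  finally show ?thesis ..
qed

lemma wallis_odd: "odd i \<Longrightarrow> wallis i j = 0"
proof (induction i arbitrary: j rule: induct_nat_012)
  case 1
  have "((\<lambda>t. cos t ^ 1 * sin t ^ j) has_integral (sin pi ^ Suc j / (1 + real j) - sin 0 ^ Suc j / (1 + real j))) {0..pi}"
  proof (rule fundamental_theorem_of_calculus)
    fix t :: real
    have "((\<lambda>t. sin t ^ Suc j / (1 + real j)) has_real_derivative
        (1 + real j) * (cos t * sin t ^ j) / (1 + real j)) (at t within {0..pi})"
      by (rule DERIV_power_Suc[OF DERIV_sin, THEN DERIV_cdivide, THEN has_field_derivative_at_within])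
    then show "((\<lambda>t. sin t ^ Suc j / (1 + real j)) has_vector_derivative cos t ^ 1 * sin t ^ j) (at t within {0..pi})"
      by (simp add: has_real_derivative_iff_has_vector_derivative[symmetric] add_pos_nonneg less_imp_neq[symmetric])
  qed simp
  then show ?case unfolding wallis_def by (simp add: integral_unique)
next
  case (ge2 n)
  then show ?case using wallis_recursion[of j n] by simp
qed simp

lemma wallis_0_2: "wallis 0 2 = pi / 2"
proof -
  have "wallis 0 0 = pi" by (simp add: wallis_def)
  then show ?thesis using wallis_split[of 0 0] wallis_recursion[of 0 0] by (simp add: numeral_2_eq_2)
qed

text \<open>The moment of s^i t^j under the uniform law on the unit disk. With s = cos \<phi> the
  chord at s is |t| \<le> sin \<phi>; integrating t^j over it and the Jacobian sin \<phi> give the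
  exponent j + 2, and 1 / pi normalises the area.\<close>

definition disk_moment :: "nat \<Rightarrow> nat \<Rightarrow> real" where
  "disk_moment i j = (if even j then 2 / (pi * real (j + 1)) * wallis i (j + 2) else 0)"

text \<open>Infinitesimal rotation invariance of the disk. \<open>mom2_recursion\<close> is the same
  relation for Haar measure at even exponents, so the joint moments agree once those with j = 0
  do.\<close>

lemma disk_moment_recursion:
  "real (i + 1) * disk_moment i (j + 2) = real (j + 1) * disk_moment (i + 2) j"
proof (cases "even j")
  case True
  have W: "real (j + 3) * wallis (i + 2) (j + 2) = real (i + 1) * wallis i (j + 4)"
    using wallis_recursion[of "j + 2" i] by (simp add: numeral_eq_Suc)
  have "real (i + 1) * disk_moment i (j + 2) = 2 / (pi * real (j + 3)) * (real (i + 1) * wallis i (j + 4))"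
  proof -
    have "even (j + 2)" "j + 2 + 1 = j + 3" "j + 2 + 2 = j + 4" using True by simp_all
    then show ?thesis by (simp only: disk_moment_def if_True mult.left_commute)
  qed
  also have "\<dots> = 2 / pi * wallis (i + 2) (j + 2)"
    unfolding W[symmetric] by (simp add: divide_simps)
  also have "\<dots> = real (j + 1) * disk_moment (i + 2) j"
    using True by (simp add: disk_moment_def divide_simps)
  finally show ?thesis .
qed (simp add: disk_moment_def)

text \<open>The disk side of \<open>mom_recursion\<close>, obtained by eliminating
  \<open>wallis (2 * k) 4\<close>.\<close>

lemma disk_moment_0_recursion:
  "real (2 * k + 4) * disk_moment (2 * k + 2) 0 = real (2 * k + 1) * disk_moment (2 * k) 0"
proof -
  have "3 * wallis (2 * k + 2) 2 = real (2 * k + 1) * wallis (2 * k) 4"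
    using wallis_recursion[of 2 "2 * k"] by simp
  moreover have "wallis (2 * k) 2 = wallis (2 * k + 2) 2 + wallis (2 * k) 4"
    using wallis_split[of "2 * k" 2] by simp
  ultimately have "real (2 * k + 4) * wallis (2 * k + 2) 2 = real (2 * k + 1) * wallis (2 * k) 2"
    by (simp add: algebra_simps)
  then show ?thesis
    by (simp add: disk_moment_def numeral_2_eq_2[symmetric] mult.left_commute[of _ "2 / pi"])
qed

text \<open>Pads a polynomial in w^2 with zero odd coefficients, so that \<open>mom2_even\<close>
  can compare coefficients in w.\<close>

lemma sum_even_powers:
  fixes f :: "nat \<Rightarrow> real"
  shows "(\<Sum>i\<le>k. f i * w ^ (2 * i)) = (\<Sum>j\<le>2 * k. (if even j then f (j div 2) else 0) * w ^ j)"
  by (induction k) simp_all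

text \<open>For \<open>Re p = 0\<close> the coordinates \<open>s = Re (y $ 1 $ 1)\<close> and \<open>\<tau> = su2_lin p q y\<close> of the unit
  quaternion \<open>y\<close> are orthogonal; every \<open>su2_lin p q\<close> is a multiple of a translate of \<open>s\<close>.\<close>

definition su2_lin :: "complex \<Rightarrow> complex \<Rightarrow> cmat2 \<Rightarrow> real" where
  "su2_lin p q y = Re (p * y $ 1 $ 1 + q * y $ 2 $ 1)"

lemma continuous_on_su2_lin [continuous_intros]: "continuous_on S (su2_lin p q)"
  unfolding su2_lin_def by (intro continuous_intros)

section \<open>Moments forced by left invariance\<close>

context
  fixes \<mu> :: "cmat2 measure"
  assumes haar: "haar_SU2 \<mu>"
begin

lemma space_haar: "space \<mu> = SU2"
proof -
  have "sets \<mu> = sets (restrict_space borel SU2)" using haar by (simp add: haar_SU2_def)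
  then have "space \<mu> = space (restrict_space borel SU2)" by (rule sets_eq_imp_space_eq)
  then show ?thesis by (simp add: space_restrict_space)
qed

lemma measure_haar [simp]: "measure \<mu> (space \<mu>) = 1"
  using haar by (simp add: haar_SU2_def measure_def)

lemma finite_measure_haar: "finite_measure \<mu>"
  using haar by (intro finite_measureI) (simp add: haar_SU2_def)

lemma borel_measurable_haar:
  fixes h :: "cmat2 \<Rightarrow> 'a :: topological_space"
  assumes "continuous_on SU2 h"
  shows "h \<in> borel_measurable \<mu>"
proof -
  have "sets \<mu> = sets (restrict_space borel SU2)" using haar by (simp add: haar_SU2_def)
  then have "measurable \<mu> borel = measurable (restrict_space borel SU2) (borel :: 'a measure)"
    by (rule measurable_cong_sets) simp
  then show ?thesis using borel_measurable_continuous_on_restrict[OF assms] by simp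
qed

lemma integrable_haar:
  fixes h :: "cmat2 \<Rightarrow> real"
  assumes "continuous_on SU2 h"
  shows "integrable \<mu> h"
proof -
  interpret finite_measure \<mu> by (rule finite_measure_haar)
  have "bounded (h ` SU2)"
    by (intro compact_imp_bounded compact_continuous_image compact_SU2 assms)
  then obtain B where "\<And>x. x \<in> SU2 \<Longrightarrow> norm (h x) \<le> B" by (auto simp: bounded_iff)
  then show ?thesis
    by (intro integrable_const_bound[where B = B] borel_measurable_haar assms) (auto simp: space_haar)
qed

lemma integral_haar_left:
  fixes h :: "cmat2 \<Rightarrow> real"
  assumes g: "g \<in> SU2" and h: "continuous_on SU2 h"
  shows "(\<integral>y. h (g ** y) \<partial>\<mu>) = (\<integral>y. h y \<partial>\<mu>)"
proof -
  have sets: "sets \<mu> = sets (restrict_space borel SU2)" using haar by (simp add: haar_SU2_def)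
  have cont: "continuous_on S (\<lambda>y. g ** y)" for S
    unfolding matrix_matrix_mult_def by (intro continuous_intros)
  have meas: "(\<lambda>y. g ** y) \<in> measurable \<mu> \<mu>"
  proof -
    have "(\<lambda>y. g ** y) \<in> measurable \<mu> (restrict_space borel SU2)"
      using g by (intro measurable_restrict_space2 borel_measurable_haar cont) (auto simp: space_haar SU2_mult)
    then show ?thesis using measurable_cong_sets[OF refl sets, of \<mu>] by simp
  qed
  have inv: "ctrans g ** g = mat 1" "g ** ctrans g = mat 1" using g by (auto simp: SU2_def)
  have "distr \<mu> \<mu> (\<lambda>y. g ** y) = \<mu>"
  proof (rule measure_eqI)
    fix A assume "A \<in> sets (distr \<mu> \<mu> (\<lambda>y. g ** y))"
    then have A: "A \<in> sets \<mu>" by simp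
    then have AS: "A \<subseteq> SU2" using sets.sets_into_space space_haar by auto
    \<comment> \<open>\<open>haar_SU2\<close> speaks of images, a push-forward of preimages: the
      preimage under \<open>g\<close> is the image under its inverse.\<close>
    have "(\<lambda>y. g ** y) -` A \<inter> space \<mu> = (\<lambda>y. ctrans g ** y) ` A"
    proof (intro set_eqI iffI)
      fix y assume "y \<in> (\<lambda>y. g ** y) -` A \<inter> space \<mu>"
      moreover have "y = ctrans g ** (g ** y)" by (simp add: matrix_mul_assoc inv matrix_mul_lid)
      ultimately show "y \<in> (\<lambda>y. ctrans g ** y) ` A" by blast
    next
      fix y assume "y \<in> (\<lambda>y. ctrans g ** y) ` A"
      then obtain z where "z \<in> A" "y = ctrans g ** z" by blast
      moreover from this have "g ** y = z" by (simp add: matrix_mul_assoc inv matrix_mul_lid)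
      ultimately show "y \<in> (\<lambda>y. g ** y) -` A \<inter> space \<mu>"
        using AS g by (auto simp: space_haar intro!: SU2_mult ctrans_SU2)
    qed
    then show "emeasure (distr \<mu> \<mu> (\<lambda>y. g ** y)) A = emeasure \<mu> A"
      using haar ctrans_SU2[OF g] A by (simp add: emeasure_distr[OF meas] haar_SU2_def)
  qed simp
  then have "(\<integral>y. h y \<partial>\<mu>) = (\<integral>y. h y \<partial>distr \<mu> \<mu> (\<lambda>y. g ** y))" by simp
  also have "\<dots> = (\<integral>y. h (g ** y) \<partial>\<mu>)"
    by (rule integral_distr[OF meas borel_measurable_haar[OF h]])
  finally show ?thesis ..
qed

definition mom :: "nat \<Rightarrow> real" where
  "mom d = (\<integral>y. Re (y $ 1 $ 1) ^ d \<partial>\<mu>)"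

lemma mom_0: "mom 0 = 1"
  by (simp add: mom_def)

lemma integral_su2_lin_power:
  assumes "0 \<le> r" "(cmod p)\<^sup>2 + (cmod q)\<^sup>2 = r\<^sup>2"
  shows "(\<integral>y. su2_lin p q y ^ d \<partial>\<mu>) = r ^ d * mom d"
proof (cases "r = 0")
  case True
  then have "p = 0" "q = 0" using assms(2) by (auto simp: add_nonneg_eq_0_iff)
  with True show ?thesis
    by (cases "d = 0") (simp_all add: mom_0 su2_lin_def)
next
  case False
  define g where "g = su2 (p / r) (q / r)"
  have "(cmod (p / r))\<^sup>2 + (cmod (q / r))\<^sup>2 = ((cmod p)\<^sup>2 + (cmod q)\<^sup>2) / r\<^sup>2"
    by (simp add: norm_divide power_divide add_divide_distrib)
  then have g: "g \<in> SU2" using assms False by (simp add: g_def su2_in_SU2_iff)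
  have "su2_lin p q y = r * Re ((g ** y) $ 1 $ 1)" for y
    using False by (simp add: su2_lin_def g_def cmat2_mult_nth complex_is_Real_iff Re_divide_of_real Im_divide_of_real field_simps)
  then have "(\<integral>y. su2_lin p q y ^ d \<partial>\<mu>) = (\<integral>y. r ^ d * Re ((g ** y) $ 1 $ 1) ^ d \<partial>\<mu>)"
    by (simp add: power_mult_distrib)
  also have "\<dots> = r ^ d * (\<integral>y. Re ((g ** y) $ 1 $ 1) ^ d \<partial>\<mu>)"
    by simp
  also have "(\<integral>y. Re ((g ** y) $ 1 $ 1) ^ d \<partial>\<mu>) = mom d"
    unfolding mom_def by (rule integral_haar_left[OF g]) (intro continuous_intros)
  finally show ?thesis .
qed

definition mom2 :: "complex \<Rightarrow> complex \<Rightarrow> nat \<Rightarrow> nat \<Rightarrow> real" where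
  "mom2 p q i j = (\<integral>y. Re (y $ 1 $ 1) ^ i * su2_lin p q y ^ j \<partial>\<mu>)"

text \<open>Translation by -1, an element of SU(2), changes the sign of both linear forms.\<close>

lemma mom2_odd:
  assumes "odd (i + j)"
  shows "mom2 p q i j = 0"
proof -
  define h where "h y = Re (y $ 1 $ 1) ^ i * su2_lin p q y ^ j" for y
  have g: "su2 (-1) 0 \<in> SU2" by (simp add: su2_in_SU2_iff)
  have neg: "su2 (-1) 0 ** y = - y" for y :: cmat2
    by (simp add: cmat2_eq_iff cmat2_mult_nth)
  have lin: "su2_lin p q (- y) = - su2_lin p q y" for y
    by (simp add: su2_lin_def)
  have "h (- y) = (-1) ^ i * Re (y $ 1 $ 1) ^ i * ((-1) ^ j * su2_lin p q y ^ j)" for y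
    unfolding h_def power_mult_distrib[symmetric] by (simp add: lin)
  then have "h (- y) = (-1) ^ (i + j) * h y" for y
    by (simp only: h_def power_add mult_ac)
  then have "h (su2 (-1) 0 ** y) = - h y" for y
    using assms by (simp add: neg)
  then have "(\<integral>y. - h y \<partial>\<mu>) = (\<integral>y. h y \<partial>\<mu>)"
    using integral_haar_left[OF g, of h] by (simp add: h_def continuous_intros)
  then show ?thesis by (simp add: mom2_def h_def)
qed

text \<open>Compare coefficients of \<open>w\<close> in \<open>\<integral> (w s + \<tau>)^(2k) = (w\<^sup>2 + \<sigma>\<^sup>2)^k mom (2k)\<close>.\<close>

lemma mom2_even:
  assumes p: "Re p = 0" and \<sigma>: "(cmod p)\<^sup>2 + (cmod q)\<^sup>2 = \<sigma>\<^sup>2" and j: "j \<le> 2 * k"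
  shows "real (2 * k choose j) * mom2 p q j (2 * k - j) =
    (if even j then real (k choose (j div 2)) * \<sigma> ^ (2 * k - j) * mom (2 * k) else 0)"
proof -
  have "(\<Sum>j\<le>2*k. (real (2 * k choose j) * mom2 p q j (2 * k - j)) * w ^ j) =
    (\<Sum>j\<le>2*k. (if even j then real (k choose (j div 2)) * \<sigma> ^ (2 * (k - j div 2)) * mom (2 * k) else 0) * w ^ j)" for w
  proof -
    have "(\<Sum>j\<le>2*k. (real (2 * k choose j) * mom2 p q j (2 * k - j)) * w ^ j) =
       (\<Sum>j\<le>2*k. (\<integral>y. real (2 * k choose j) * (w * Re (y $ 1 $ 1)) ^ j * su2_lin p q y ^ (2 * k - j) \<partial>\<mu>))"
    proof (rule sum.cong[OF refl])
      fix j
      have "(\<lambda>y. real (2 * k choose j) * (w * Re (y $ 1 $ 1)) ^ j * su2_lin p q y ^ (2 * k - j)) =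
        (\<lambda>y. real (2 * k choose j) * w ^ j * (Re (y $ 1 $ 1) ^ j * su2_lin p q y ^ (2 * k - j)))"
        by (simp add: power_mult_distrib mult_ac)
      then show "(real (2 * k choose j) * mom2 p q j (2 * k - j)) * w ^ j =
        (\<integral>y. real (2 * k choose j) * (w * Re (y $ 1 $ 1)) ^ j * su2_lin p q y ^ (2 * k - j) \<partial>\<mu>)"
        by (simp add: mom2_def)
    qed
    also have "\<dots> = (\<integral>y. (\<Sum>j\<le>2*k. real (2 * k choose j) * (w * Re (y $ 1 $ 1)) ^ j * su2_lin p q y ^ (2 * k - j)) \<partial>\<mu>)"
      by (intro Bochner_Integration.integral_sum[symmetric] integrable_haar continuous_intros)
    also have "\<dots> = (\<integral>y. su2_lin (w + p) q y ^ (2 * k) \<partial>\<mu>)"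
      unfolding binomial_ring[symmetric] by (simp add: su2_lin_def algebra_simps)
    \<comment> \<open>Since \<open>Re p = 0\<close>, adding the real number w to p adds w^2 to the
      squared norm, so the integrand is a power of a linear form of norm sqrt(w^2 +
      \<sigma>^2).\<close>
    also have "\<dots> = sqrt (w\<^sup>2 + \<sigma>\<^sup>2) ^ (2 * k) * mom (2 * k)"
      using p \<sigma> by (intro integral_su2_lin_power) (simp_all add: cmod_power2)
    also have "\<dots> = (w\<^sup>2 + \<sigma>\<^sup>2) ^ k * mom (2 * k)"
      by (simp add: power_mult)
    also have "\<dots> = (\<Sum>i\<le>k. (real (k choose i) * \<sigma> ^ (2 * (k - i)) * mom (2 * k)) * w ^ (2 * i))"
      unfolding binomial_ring sum_distrib_right by (simp add: mult_ac flip: power_mult)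
    finally show ?thesis unfolding sum_even_powers .
  qed
  then have "\<forall>j\<le>2*k. real (2 * k choose j) * mom2 p q j (2 * k - j) =
     (if even j then real (k choose (j div 2)) * \<sigma> ^ (2 * (k - j div 2)) * mom (2 * k) else 0)"
    by (intro polyfun_eq_coeffs[THEN iffD1] allI)
  then have "real (2 * k choose j) * mom2 p q j (2 * k - j) =
     (if even j then real (k choose (j div 2)) * \<sigma> ^ (2 * (k - j div 2)) * mom (2 * k) else 0)"
    using j by blast
  then show ?thesis by (auto simp: right_diff_distrib')
qed

text \<open>Both moments have total degree 2k with k = i + b + 1, so \<open>mom2_even\<close>
  expresses each through \<open>mom (2 * k)\<close>. What remains is a relation between neighbouring
  binomial coefficients, kept multiplied out until the positive factor can be cancelled.\<close>

lemma mom2_recursion: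
  assumes p: "Re p = 0" and \<sigma>: "(cmod p)\<^sup>2 + (cmod q)\<^sup>2 = \<sigma>\<^sup>2"
  shows "real (2 * i + 1) * mom2 p q (2 * i) (2 * b + 2) = real (2 * b + 1) * \<sigma>\<^sup>2 * mom2 p q (2 * i + 2) (2 * b)"
proof -
  define k where "k = i + b + 1"
  define A B C D where "A = real (2 * k choose (2 * i))" and "B = real (2 * k choose (2 * i + 2))"
    and "C = real (k choose i)" and "D = real (k choose (i + 1))"
  have 1: "A * mom2 p q (2 * i) (2 * b + 2) = C * \<sigma> ^ (2 * b + 2) * mom (2 * k)"
    using mom2_even[OF p \<sigma>, of "2 * i" k] by (simp add: k_def A_def C_def)
  have 2: "B * mom2 p q (2 * i + 2) (2 * b) = D * \<sigma> ^ (2 * b) * mom (2 * k)"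
    using mom2_even[OF p \<sigma>, of "2 * i + 2" k] by (simp add: k_def B_def D_def)
  have D: "real (i + 1) * D = real (b + 1) * C"
    unfolding C_def D_def k_def of_nat_mult[symmetric] of_nat_eq_iff
    using Suc_times_binomial_add[of i b] by simp
  have "real (2 * i + 2) * B = real (2 * b + 1) * real (2 * k choose (2 * i + 1))"
    unfolding B_def k_def of_nat_mult[symmetric] of_nat_eq_iff
    using Suc_times_binomial_add[of "2 * i + 1" "2 * b"] by simp
  moreover have "real (2 * i + 1) * real (2 * k choose (2 * i + 1)) = real (2 * b + 2) * A"
    unfolding A_def k_def of_nat_mult[symmetric] of_nat_eq_iff
    using Suc_times_binomial_add[of "2 * i" "2 * b + 1"] by simp
  ultimately have B: "real (2 * i + 1) * real (2 * i + 2) * B = real (2 * b + 1) * real (2 * b + 2) * A"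
    by algebra
  have "0 < (2 * k choose (2 * i))" by (rule zero_less_binomial) (simp add: k_def)
  then have "A \<noteq> 0" by (simp add: A_def)
  have "(A * real (2 * b + 2)) * (real (2 * i + 1) * mom2 p q (2 * i) (2 * b + 2))
      = (A * real (2 * b + 2)) * (real (2 * b + 1) * \<sigma>\<^sup>2 * mom2 p q (2 * i + 2) (2 * b))"
  proof -
    have "(A * real (2 * b + 2)) * (real (2 * i + 1) * mom2 p q (2 * i) (2 * b + 2))
       = 2 * (real (b + 1) * C) * real (2 * i + 1) * \<sigma> ^ (2 * b + 2) * mom (2 * k)"
    proof -
      have "(A * real (2 * b + 2)) * (real (2 * i + 1) * mom2 p q (2 * i) (2 * b + 2))
        = real (2 * b + 2) * real (2 * i + 1) * (A * mom2 p q (2 * i) (2 * b + 2))"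
        by (simp only: mult_ac)
      moreover have "real (2 * b + 2) = 2 * real (b + 1)" by simp
      ultimately show ?thesis unfolding 1 by (simp only: mult_ac)
    qed
    also have "\<dots> = real (2 * i + 2) * real (2 * i + 1) * \<sigma>\<^sup>2 * (D * \<sigma> ^ (2 * b) * mom (2 * k))"
      unfolding D[symmetric] by (simp add: algebra_simps power2_eq_square)
    also have "\<dots> = (real (2 * i + 1) * real (2 * i + 2) * B) * \<sigma>\<^sup>2 * mom2 p q (2 * i + 2) (2 * b)"
      unfolding 2[symmetric] by (simp add: mult_ac)
    finally show ?thesis unfolding B by (simp add: mult_ac)
  qed
  moreover have "A * real (2 * b + 2) \<noteq> 0" using \<open>A \<noteq> 0\<close> by simp
  ultimately show ?thesis by (metis mult_left_cancel)
qed

text \<open>The squares of the four real coordinates of a unit quaternion sum to 1.\<close>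

lemma mom_recursion: "real (2 * k + 4) * mom (2 * k + 2) = real (2 * k + 1) * mom (2 * k)"
proof -
  define I where "I p q = mom2 p q (2 * k) 2" for p q
  have rec: "real (2 * k + 1) * I p q = mom (2 * k + 2)"
    if "Re p = 0" "(cmod p)\<^sup>2 + (cmod q)\<^sup>2 = 1\<^sup>2" for p q
  proof -
    have "mom2 p q (2 * k + 2) 0 = mom (2 * k + 2)" by (simp add: mom2_def mom_def)
    then show ?thesis
      using mom2_recursion[OF that, of k 0] by (simp only: I_def mult_0_right add_0) simp
  qed
  have cont: "integrable \<mu> (\<lambda>y. Re (y $ 1 $ 1) ^ (2 * k) * su2_lin p q y ^ 2)"
    "integrable \<mu> (\<lambda>y. Re (y $ 1 $ 1) ^ i)" for p q i
    by (intro integrable_haar continuous_intros)+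
  \<comment> \<open>The three forms read off, up to sign, the other three real coordinates of
    \<open>y\<close>; by \<open>rec\<close> they contribute equally, whence the factor 3
    below.\<close>
  have "I \<i> 0 + I 0 1 + I 0 \<i> = (\<integral>y. Re (y $ 1 $ 1) ^ (2 * k) * su2_lin \<i> 0 y ^ 2 +
     Re (y $ 1 $ 1) ^ (2 * k) * su2_lin 0 1 y ^ 2 + Re (y $ 1 $ 1) ^ (2 * k) * su2_lin 0 \<i> y ^ 2 \<partial>\<mu>)"
    unfolding I_def mom2_def using cont by simp
  also have "\<dots> = (\<integral>y. Re (y $ 1 $ 1) ^ (2 * k) - Re (y $ 1 $ 1) ^ (2 * k + 2) \<partial>\<mu>)"
  proof (rule Bochner_Integration.integral_cong[OF refl])
    fix y assume "y \<in> space \<mu>"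
    then obtain p q where y: "y = su2 p q" "(cmod p)\<^sup>2 + (cmod q)\<^sup>2 = 1"
      by (metis SU2_cases space_haar)
    then have "(Im p)\<^sup>2 + (Re q)\<^sup>2 + (Im q)\<^sup>2 = 1 - (Re p)\<^sup>2" by (simp add: cmod_power2)
    then have "Re p ^ (2 * k) * ((Im p)\<^sup>2 + (Re q)\<^sup>2 + (Im q)\<^sup>2) = Re p ^ (2 * k) - Re p ^ (2 * k + 2)"
      by (simp add: right_diff_distrib power_add power2_eq_square)
    then show "Re (y $ 1 $ 1) ^ (2 * k) * su2_lin \<i> 0 y ^ 2 +
     Re (y $ 1 $ 1) ^ (2 * k) * su2_lin 0 1 y ^ 2 + Re (y $ 1 $ 1) ^ (2 * k) * su2_lin 0 \<i> y ^ 2 =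
     Re (y $ 1 $ 1) ^ (2 * k) - Re (y $ 1 $ 1) ^ (2 * k + 2)"
      by (simp add: y su2_lin_def distrib_left)
  qed
  also have "\<dots> = mom (2 * k) - mom (2 * k + 2)"
    unfolding mom_def by (intro Bochner_Integration.integral_diff cont)
  finally have "real (2 * k + 1) * I \<i> 0 + real (2 * k + 1) * I 0 1 + real (2 * k + 1) * I 0 \<i> =
     real (2 * k + 1) * (mom (2 * k) - mom (2 * k + 2))"
    by (simp only: distrib_left[symmetric])
  then have "3 * mom (2 * k + 2) = real (2 * k + 1) * (mom (2 * k) - mom (2 * k + 2))"
    using rec[of \<i> 0] rec[of 0 1] rec[of 0 \<i>] by (simp del: of_nat_add of_nat_mult)
  then show ?thesis by (simp add: algebra_simps)
qed

lemma mom_eq_disk_moment: "mom (2 * k) = disk_moment (2 * k) 0"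
proof (induction k)
  case 0
  then show ?case using wallis_0_2 by (simp add: mom_0 disk_moment_def numeral_2_eq_2)
next
  case (Suc k)
  have "real (2 * k + 4) * mom (2 * k + 2) = real (2 * k + 4) * disk_moment (2 * k + 2) 0"
    unfolding mom_recursion disk_moment_0_recursion Suc ..
  then have "mom (2 * k + 2) = disk_moment (2 * k + 2) 0"
    by (subst (asm) mult_left_cancel) auto
  then show ?case by simp
qed

text \<open>Each step in \<open>b\<close> trades two powers of the second coordinate for two of the
  first, which is why \<open>i\<close> varies in the induction.\<close>

lemma mom2_even_even:
  assumes p: "Re p = 0" and \<sigma>: "(cmod p)\<^sup>2 + (cmod q)\<^sup>2 = \<sigma>\<^sup>2"
  shows "mom2 p q (2 * i) (2 * b) = \<sigma> ^ (2 * b) * disk_moment (2 * i) (2 * b)"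
proof (induction b arbitrary: i)
  case 0
  then show ?case using mom_eq_disk_moment[of i] by (simp add: mom2_def mom_def)
next
  case (Suc b)
  have "real (2 * i + 1) * mom2 p q (2 * i) (2 * b + 2) = real (2 * b + 1) * \<sigma>\<^sup>2 * mom2 p q (2 * (i + 1)) (2 * b)"
    using mom2_recursion[OF assms, of i b] by simp
  also have "\<dots> = \<sigma> ^ (2 * b + 2) * (real (2 * b + 1) * disk_moment (2 * i + 2) (2 * b))"
    unfolding Suc by (simp add: algebra_simps power2_eq_square)
  also have "\<dots> = real (2 * i + 1) * (\<sigma> ^ (2 * b + 2) * disk_moment (2 * i) (2 * b + 2))"
    unfolding disk_moment_recursion[symmetric] by (simp add: mult_ac)
  finally have "mom2 p q (2 * i) (2 * b + 2) = \<sigma> ^ (2 * b + 2) * disk_moment (2 * i) (2 * b + 2)"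
    by (subst (asm) mult_left_cancel) auto
  then show ?case by simp
qed

lemma mom2_eq_disk_moment:
  assumes p: "Re p = 0" and \<sigma>: "(cmod p)\<^sup>2 + (cmod q)\<^sup>2 = \<sigma>\<^sup>2"
  shows "mom2 p q i j = \<sigma> ^ j * disk_moment i j"
proof (cases "even i")
  case True
  show ?thesis
  proof (cases "even j")
    case True
    with \<open>even i\<close> show ?thesis using mom2_even_even[OF assms] by (auto elim!: evenE)
  next
    case False
    with \<open>even i\<close> show ?thesis by (simp add: mom2_odd disk_moment_def)
  qed
next
  case False
  show ?thesis
  proof (cases "even j")
    case True
    with \<open>odd i\<close> show ?thesis by (simp add: mom2_odd disk_moment_def wallis_odd)
  next
    case False
    \<comment> \<open>With both exponents odd the total degree is even and the symmetry under -1
      says nothing; but the moment is an odd coefficient of a polynomial in w^2.\<close>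
    define k where "k = (i + j) div 2"
    have k: "2 * k = i + j" using False \<open>odd i\<close> by (simp add: k_def)
    have "real (2 * k choose i) * mom2 p q i j = 0"
      using mom2_even[OF assms, of i k] k \<open>odd i\<close> by simp
    moreover have "i \<le> 2 * k" using k by simp
    ultimately have "mom2 p q i j = 0" by (simp add: binomial_eq_0_iff)
    with False show ?thesis by (simp add: disk_moment_def)
  qed
qed

end

section \<open>From moments to integrals over the disk\<close>

lemma integral_power_symmetric:
  fixes s :: real
  assumes "0 \<le> s"
  shows "integral {- s..s} (\<lambda>t. t ^ j) = (if even j then 2 / real (j + 1) * s ^ (j + 1) else 0)"
proof -
  have "((\<lambda>t. t ^ j) has_integral (s ^ Suc j / (1 + real j) - (- s) ^ Suc j / (1 + real j))) {- s..s}"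
  proof (rule fundamental_theorem_of_calculus)
    fix t :: real
    have "((\<lambda>t. t ^ Suc j / (1 + real j)) has_real_derivative (1 + real j) * (1 * t ^ j) / (1 + real j)) (at t within {- s..s})"
      by (rule DERIV_power_Suc[OF DERIV_ident, THEN DERIV_cdivide, THEN has_field_derivative_at_within])
    then show "((\<lambda>t. t ^ Suc j / (1 + real j)) has_vector_derivative t ^ j) (at t within {- s..s})"
      by (simp add: has_real_derivative_iff_has_vector_derivative[symmetric] add_pos_nonneg less_imp_neq[symmetric])
  qed (use assms in simp)
  then show ?thesis by (simp add: integral_unique)
qed

lemma has_integral_disk_moment:
  "((\<lambda>\<phi>. cos \<phi> ^ i * sin \<phi> * integral {- sin \<phi>..sin \<phi>} (\<lambda>t. t ^ j)) has_integral pi * disk_moment i j) {0..pi}"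
proof (cases "even j")
  case True
  have "((\<lambda>\<phi>. 2 / real (j + 1) * (cos \<phi> ^ i * sin \<phi> ^ (j + 2))) has_integral 2 / real (j + 1) * wallis i (j + 2)) {0..pi}"
    unfolding wallis_def by (intro has_integral_mult_right integrable_integral wallis_integrable)
  then have "((\<lambda>\<phi>. 2 / real (j + 1) * (cos \<phi> ^ i * sin \<phi> ^ (j + 2))) has_integral pi * disk_moment i j) {0..pi}"
    using True by (simp add: disk_moment_def)
  then show ?thesis
    by (rule has_integral_eq[rotated]) (use True in \<open>simp add: integral_power_symmetric sin_ge_zero\<close>)
next
  case False
  then have "((\<lambda>\<phi>::real. 0) has_integral pi * disk_moment i j) {0..pi}" by (simp add: disk_moment_def)
  then show ?thesis
    by (rule has_integral_eq[rotated]) (use False in \<open>simp add: integral_power_symmetric sin_ge_zero\<close>)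
qed

lemma has_integral_disk_moment_binomial:
  "((\<lambda>\<phi>. cos \<phi> ^ i * sin \<phi> * integral {- sin \<phi>..sin \<phi>} (\<lambda>t. (c * cos \<phi> + \<sigma> * t) ^ l))
    has_integral pi * (\<Sum>b\<le>l. real (l choose b) * c ^ b * \<sigma> ^ (l - b) * disk_moment (i + b) (l - b))) {0..pi}"
proof -
  have "((\<lambda>\<phi>. \<Sum>b\<le>l. real (l choose b) * c ^ b * \<sigma> ^ (l - b) *
       (cos \<phi> ^ (i + b) * sin \<phi> * integral {- sin \<phi>..sin \<phi>} (\<lambda>t. t ^ (l - b))))
    has_integral (\<Sum>b\<le>l. real (l choose b) * c ^ b * \<sigma> ^ (l - b) * (pi * disk_moment (i + b) (l - b)))) {0..pi}"
    by (intro has_integral_sum has_integral_mult_right has_integral_disk_moment) auto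
  moreover have "(\<Sum>b\<le>l. real (l choose b) * c ^ b * \<sigma> ^ (l - b) *
       (cos \<phi> ^ (i + b) * sin \<phi> * integral {- sin \<phi>..sin \<phi>} (\<lambda>t. t ^ (l - b)))) =
       cos \<phi> ^ i * sin \<phi> * integral {- sin \<phi>..sin \<phi>} (\<lambda>t. (c * cos \<phi> + \<sigma> * t) ^ l)" for \<phi> :: real
  proof -
    have "integral {- sin \<phi>..sin \<phi>} (\<lambda>t. (c * cos \<phi> + \<sigma> * t) ^ l) =
      integral {- sin \<phi>..sin \<phi>} (\<lambda>t. \<Sum>b\<le>l. (real (l choose b) * (c * cos \<phi>) ^ b * \<sigma> ^ (l - b)) * t ^ (l - b))"
      unfolding binomial_ring by (simp add: power_mult_distrib mult_ac)
    also have "\<dots> = (\<Sum>b\<le>l. integral {- sin \<phi>..sin \<phi>} (\<lambda>t. (real (l choose b) * (c * cos \<phi>) ^ b * \<sigma> ^ (l - b)) * t ^ (l - b)))"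
      by (intro Henstock_Kurzweil_Integration.integral_sum integrable_continuous_real continuous_intros) auto
    also have "\<dots> = (\<Sum>b\<le>l. (real (l choose b) * (c * cos \<phi>) ^ b * \<sigma> ^ (l - b)) * integral {- sin \<phi>..sin \<phi>} (\<lambda>t. t ^ (l - b)))"
      by simp
    finally show ?thesis by (simp add: sum_distrib_left power_add power_mult_distrib mult_ac)
  qed
  ultimately show ?thesis by (simp add: sum_distrib_left mult_ac)
qed

lemma cmod_pure_imaginary_part:
  assumes "(cmod p)\<^sup>2 + (cmod q)\<^sup>2 = 1"
  shows "(cmod (\<i> * Im p))\<^sup>2 + (cmod q)\<^sup>2 = 1 - (Re p)\<^sup>2"
  using assms by (simp add: cmod_power2 norm_mult)

context
  fixes \<mu> :: "cmat2 measure"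
  assumes haar: "haar_SU2 \<mu>"
begin

text \<open>The disk law in integrated form. A general linear form is c s plus a form orthogonal to
  s, so the binomial theorem reduces each monomial of \<open>P\<close> to joint moments.\<close>

lemma has_integral_poly_su2_lin:
  assumes q': "real_polynomial_function P"
    and p: "Re p = 0" and \<sigma>: "(cmod p)\<^sup>2 + (cmod q)\<^sup>2 = \<sigma>\<^sup>2"
  shows "((\<lambda>\<phi>. cos \<phi> ^ i * sin \<phi> * integral {- sin \<phi>..sin \<phi>} (\<lambda>t. P (c * cos \<phi> + \<sigma> * t)))
    has_integral pi * (\<integral>y. Re (y $ 1 $ 1) ^ i * P (c * Re (y $ 1 $ 1) + su2_lin p q y) \<partial>\<mu>)) {0..pi}"
proof -
  obtain a m where P: "P = (\<lambda>x. \<Sum>l\<le>m. a l * x ^ l)"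
    using real_polynomial_function_imp_sum[OF q'] by blast
  define V where "V l = (\<integral>y. Re (y $ 1 $ 1) ^ i * (c * Re (y $ 1 $ 1) + su2_lin p q y) ^ l \<partial>\<mu>)" for l
  have V: "V l = (\<Sum>b\<le>l. real (l choose b) * c ^ b * \<sigma> ^ (l - b) * disk_moment (i + b) (l - b))" for l
  proof -
    have "V l = (\<integral>y. (\<Sum>b\<le>l. (real (l choose b) * c ^ b) * (Re (y $ 1 $ 1) ^ (i + b) * su2_lin p q y ^ (l - b))) \<partial>\<mu>)"
      unfolding V_def binomial_ring by (simp add: power_add power_mult_distrib sum_distrib_left mult_ac)
    also have "\<dots> = (\<Sum>b\<le>l. (\<integral>y. (real (l choose b) * c ^ b) * (Re (y $ 1 $ 1) ^ (i + b) * su2_lin p q y ^ (l - b)) \<partial>\<mu>))"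
      by (intro Bochner_Integration.integral_sum integrable_haar[OF haar] continuous_intros)
    also have "\<dots> = (\<Sum>b\<le>l. (real (l choose b) * c ^ b) * mom2 \<mu> p q (i + b) (l - b))"
      by (simp add: mom2_def[OF haar])
    finally show ?thesis by (simp add: mom2_eq_disk_moment[OF haar p \<sigma>] mult_ac)
  qed
  have "(\<integral>y. Re (y $ 1 $ 1) ^ i * P (c * Re (y $ 1 $ 1) + su2_lin p q y) \<partial>\<mu>) =
    (\<integral>y. (\<Sum>l\<le>m. a l * (Re (y $ 1 $ 1) ^ i * (c * Re (y $ 1 $ 1) + su2_lin p q y) ^ l)) \<partial>\<mu>)"
    by (simp add: P sum_distrib_left mult_ac)
  also have "\<dots> = (\<Sum>l\<le>m. (\<integral>y. a l * (Re (y $ 1 $ 1) ^ i * (c * Re (y $ 1 $ 1) + su2_lin p q y) ^ l) \<partial>\<mu>))"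
    by (intro Bochner_Integration.integral_sum integrable_haar[OF haar] continuous_intros)
  also have "\<dots> = (\<Sum>l\<le>m. a l * V l)" by (simp add: V_def)
  finally have E: "(\<integral>y. Re (y $ 1 $ 1) ^ i * P (c * Re (y $ 1 $ 1) + su2_lin p q y) \<partial>\<mu>) = (\<Sum>l\<le>m. a l * V l)" .
  have "((\<lambda>\<phi>. \<Sum>l\<le>m. a l * (cos \<phi> ^ i * sin \<phi> * integral {- sin \<phi>..sin \<phi>} (\<lambda>t. (c * cos \<phi> + \<sigma> * t) ^ l)))
    has_integral (\<Sum>l\<le>m. a l * (pi * V l))) {0..pi}"
    unfolding V by (intro has_integral_sum has_integral_mult_right has_integral_disk_moment_binomial) auto
  moreover have "(\<Sum>l\<le>m. a l * (cos \<phi> ^ i * sin \<phi> * integral {- sin \<phi>..sin \<phi>} (\<lambda>t. (c * cos \<phi> + \<sigma> * t) ^ l))) =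
     cos \<phi> ^ i * sin \<phi> * integral {- sin \<phi>..sin \<phi>} (\<lambda>t. P (c * cos \<phi> + \<sigma> * t))" for \<phi> :: real
  proof -
    have "integral {- sin \<phi>..sin \<phi>} (\<lambda>t. P (c * cos \<phi> + \<sigma> * t)) =
      (\<Sum>l\<le>m. integral {- sin \<phi>..sin \<phi>} (\<lambda>t. a l * (c * cos \<phi> + \<sigma> * t) ^ l))"
      unfolding P
      by (intro Henstock_Kurzweil_Integration.integral_sum integrable_continuous_real continuous_intros) auto
    then show ?thesis by (simp add: sum_distrib_left mult_ac)
  qed
  ultimately show ?thesis by (simp add: E sum_distrib_left mult_ac)
qed

text \<open>Writing Re p = cos \<theta>, the part of \<open>su2_lin p q\<close> orthogonal to s has
  norm sin \<theta>; then \<open>integral_cheb_u\<close> evaluates the chord integral and pulls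
  \<open>cheb_u n (Re p)\<close> out of it.\<close>

lemma integral_power_cheb_u:
  assumes "(cmod p)\<^sup>2 + (cmod q)\<^sup>2 = 1" "n > 0"
  shows "(\<integral>y. Re (y $ 1 $ 1) ^ i * cheb_u n (su2_lin p q y) \<partial>\<mu>) =
    2 / (pi * real n) * cheb_u n (Re p) * integral {0..pi} (\<lambda>\<phi>. cos \<phi> ^ i * (sin \<phi> * sin (real n * \<phi>)))"
proof -
  have solve: "X = 2 / (pi * real n) * U * J" if "pi * X = 2 / real n * U * J" for X U J
    using that assms(2) by (simp add: field_simps)
  have "su2 p q \<in> SU2" using assms by (simp add: su2_in_SU2_iff)
  then have "\<bar>Re p\<bar> \<le> 1" using abs_Re_SU2_le by fastforce
  define \<theta> where "\<theta> = arccos (Re p)"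
  have c: "cos \<theta> = Re p" using \<open>\<bar>Re p\<bar> \<le> 1\<close> by (simp add: \<theta>_def)
  have s: "(cmod (\<i> * Im p))\<^sup>2 + (cmod q)\<^sup>2 = (sin \<theta>)\<^sup>2"
    using cmod_pure_imaginary_part[OF assms(1)] by (simp add: sin_squared_eq c)
  have lin: "Re p * Re (y $ 1 $ 1) + su2_lin (\<i> * Im p) q y = su2_lin p q y" for y
    by (simp add: su2_lin_def)
  have "((\<lambda>\<phi>. cos \<phi> ^ i * sin \<phi> * integral {- sin \<phi>..sin \<phi>} (\<lambda>t. cheb_u n (cos \<theta> * cos \<phi> + sin \<theta> * t)))
    has_integral pi * (\<integral>y. Re (y $ 1 $ 1) ^ i * cheb_u n (su2_lin p q y) \<partial>\<mu>)) {0..pi}"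
    using has_integral_poly_su2_lin[OF real_polynomial_function_cheb_u[of n] _ s, of i "cos \<theta>"]
    by (simp add: c lin)
  then have "((\<lambda>\<phi>. 2 / real n * cheb_u n (Re p) * (cos \<phi> ^ i * (sin \<phi> * sin (real n * \<phi>))))
    has_integral pi * (\<integral>y. Re (y $ 1 $ 1) ^ i * cheb_u n (su2_lin p q y) \<partial>\<mu>)) {0..pi}"
    by (rule has_integral_eq[rotated]) (use assms(2) in \<open>simp add: integral_cheb_u[where \<theta> = \<theta>, unfolded c] c\<close>)
  then have "integral {0..pi} (\<lambda>\<phi>. 2 / real n * cheb_u n (Re p) * (cos \<phi> ^ i * (sin \<phi> * sin (real n * \<phi>)))) =
    pi * (\<integral>y. Re (y $ 1 $ 1) ^ i * cheb_u n (su2_lin p q y) \<partial>\<mu>)"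
    by (rule integral_unique)
  then have "pi * (\<integral>y. Re (y $ 1 $ 1) ^ i * cheb_u n (su2_lin p q y) \<partial>\<mu>) =
    2 / real n * cheb_u n (Re p) * integral {0..pi} (\<lambda>\<phi>. cos \<phi> ^ i * (sin \<phi> * sin (real n * \<phi>)))"
    by (simp only: Henstock_Kurzweil_Integration.integral_mult_right)
  then show ?thesis by (rule solve)
qed

lemma abs_integral_haar_le:
  fixes h :: "cmat2 \<Rightarrow> real"
  assumes "continuous_on SU2 h" "\<And>y. y \<in> SU2 \<Longrightarrow> \<bar>h y\<bar> \<le> B"
  shows "\<bar>\<integral>y. h y \<partial>\<mu>\<bar> \<le> B"
proof -
  have "\<bar>\<integral>y. h y \<partial>\<mu>\<bar> \<le> (\<integral>y. \<bar>h y\<bar> \<partial>\<mu>)" by (rule integral_abs_bound)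
  also have "\<dots> \<le> (\<integral>y. B \<partial>\<mu>)"
    using assms by (intro integral_mono integrable_haar[OF haar] continuous_intros) (auto simp: space_haar[OF haar])
  finally show ?thesis using haar by simp
qed

text \<open>Funk-Hecke formula. If (p, q) is the first row of x, then
  \<open>cheb_u n (su2_lin p q y)\<close> is chi_{n-1}(x y), so characters are eigenfunctions of
  this averaging. Both sides are continuous in \<Phi> for the sup norm, and polynomials are
  dense.\<close>

lemma integral_continuous_cheb_u:
  assumes pq: "(cmod p)\<^sup>2 + (cmod q)\<^sup>2 = 1" and "n > 0" and \<Phi>: "continuous_on {-1..1} \<Phi>"
  shows "(\<integral>y. \<Phi> (Re (y $ 1 $ 1)) * cheb_u n (su2_lin p q y) \<partial>\<mu>) =
    2 / (pi * real n) * cheb_u n (Re p) * integral {0..pi} (\<lambda>\<phi>. \<Phi> (cos \<phi>) * (sin \<phi> * sin (real n * \<phi>)))"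
proof -
  define E where "E f = (\<integral>y. f (Re (y $ 1 $ 1)) * cheb_u n (su2_lin p q y) \<partial>\<mu>)" for f
  define I where "I f = integral {0..pi} (\<lambda>\<phi>. f (cos \<phi>) * (sin \<phi> * sin (real n * \<phi>)))" for f :: "real \<Rightarrow> real"
  define C where "C = 2 / (pi * real n) * cheb_u n (Re p)"
  have g: "su2 p q \<in> SU2" using pq by (simp add: su2_in_SU2_iff)
  have cu: "continuous_on SU2 (\<lambda>y. cheb_u n (su2_lin p q y))"
    by (rule continuous_on_cheb_u) (rule continuous_on_su2_lin)
  have cs: "continuous_on SU2 (\<lambda>y :: cmat2. Re (y $ 1 $ 1))" by (intro continuous_intros)
  have poly: "E P = C * I P" if "real_polynomial_function P" for P
  proof -
    obtain a m where P: "P = (\<lambda>x. \<Sum>l\<le>m. a l * x ^ l)"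
      using real_polynomial_function_imp_sum[OF \<open>real_polynomial_function P\<close>] by blast
    have "E P = (\<integral>y. (\<Sum>l\<le>m. a l * (Re (y $ 1 $ 1) ^ l * cheb_u n (su2_lin p q y))) \<partial>\<mu>)"
      by (simp add: E_def P sum_distrib_right mult.assoc)
    also have "\<dots> = (\<Sum>l\<le>m. (\<integral>y. a l * (Re (y $ 1 $ 1) ^ l * cheb_u n (su2_lin p q y)) \<partial>\<mu>))"
      by (intro Bochner_Integration.integral_sum integrable_haar[OF haar] continuous_on_mult
          continuous_on_const continuous_on_power cu cs)
    also have "\<dots> = (\<Sum>l\<le>m. a l * (C * I (\<lambda>x. x ^ l)))"
      by (simp add: integral_power_cheb_u[OF pq \<open>n > 0\<close>] C_def I_def)
    also have "\<dots> = C * (\<Sum>l\<le>m. integral {0..pi} (\<lambda>\<phi>. a l * (cos \<phi> ^ l * (sin \<phi> * sin (real n * \<phi>)))))"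
      by (simp add: I_def sum_distrib_left mult.left_commute[of _ C])
    also have "(\<Sum>l\<le>m. integral {0..pi} (\<lambda>\<phi>. a l * (cos \<phi> ^ l * (sin \<phi> * sin (real n * \<phi>))))) =
       integral {0..pi} (\<lambda>\<phi>. \<Sum>l\<le>m. a l * (cos \<phi> ^ l * (sin \<phi> * sin (real n * \<phi>))))"
      by (intro Henstock_Kurzweil_Integration.integral_sum[symmetric] integrable_continuous_real continuous_intros) auto
    also have "\<dots> = I P" by (simp add: I_def P sum_distrib_right mult.assoc)
    finally show ?thesis .
  qed
  have cos_in: "cos \<phi> \<in> {-1..1}" for \<phi> :: real by simp
  have Re_in: "Re (y $ 1 $ 1) \<in> {-1..1}" if "y \<in> SU2" for y
    using abs_Re_SU2_le[OF that] by (simp add: abs_le_iff)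
  have lin: "\<bar>su2_lin p q y\<bar> \<le> 1" if "y \<in> SU2" for y
    using abs_Re_SU2_le[OF SU2_mult[OF g that]] by (simp add: cmat2_mult_nth su2_lin_def)
  have Cle: "\<bar>C\<bar> \<le> 2 / pi"
    using abs_cheb_u_le[of "Re p" n] abs_Re_SU2_le[OF g] \<open>n > 0\<close>
    by (simp add: C_def abs_mult divide_simps)
  \<comment> \<open>\<open>real n\<close> bounds the character on the Haar side; the 2 is the bound
    2 / pi for \<open>C\<close> times the length pi of the interval.\<close>
  have close: "\<bar>E \<Phi> - C * I \<Phi>\<bar> \<le> e * (real n + 2)" if "0 < e" for e
  proof -
    obtain P where P: "real_polynomial_function P" and e: "\<And>x. x \<in> {-1..1} \<Longrightarrow> \<bar>\<Phi> x - P x\<bar> < e"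
      using Stone_Weierstrass_real_polynomial_function[OF compact_Icc \<Phi> \<open>0 < e\<close>] by blast
    have contP: "continuous_on S P" for S
      using P by (intro continuous_on_polymonial_function) (simp add: real_polynomial_function_eq[symmetric])
    have cy: "continuous_on SU2 (\<lambda>y. f (Re (y $ 1 $ 1)) * cheb_u n (su2_lin p q y))"
      if "continuous_on {-1..1} f" for f :: "real \<Rightarrow> real"
      by (intro continuous_on_mult cu continuous_on_compose2[OF that cs]) (use Re_in in auto)
    have cp: "continuous_on {0..pi} (\<lambda>\<phi>. f (cos \<phi>) * (sin \<phi> * sin (real n * \<phi>)))"
      if "continuous_on {-1..1} f" for f :: "real \<Rightarrow> real"
      by (intro continuous_on_mult continuous_on_sin continuous_on_const continuous_on_id
          continuous_on_compose2[OF that]) (auto intro!: continuous_intros)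
    have d: "continuous_on {-1..1} (\<lambda>x. \<Phi> x - P x)" by (rule continuous_on_diff[OF \<Phi> contP])
    have "\<bar>E (\<lambda>x. \<Phi> x - P x)\<bar> \<le> e * real n"
      unfolding E_def
    proof (rule abs_integral_haar_le[OF cy[OF d]])
      fix y assume "y \<in> SU2"
      then show "\<bar>(\<Phi> (Re (y $ 1 $ 1)) - P (Re (y $ 1 $ 1))) * cheb_u n (su2_lin p q y)\<bar> \<le> e * real n"
        unfolding abs_mult
        by (intro mult_mono abs_cheb_u_le lin less_imp_le[OF e] Re_in abs_ge_zero less_imp_le[OF \<open>0 < e\<close>])
    qed
    moreover have "E (\<lambda>x. \<Phi> x - P x) = E \<Phi> - E P"
      unfolding E_def left_diff_distrib
      by (intro Bochner_Integration.integral_diff integrable_haar[OF haar] cy \<Phi> contP)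
    moreover have "\<bar>I (\<lambda>x. \<Phi> x - P x)\<bar> \<le> e * (pi - 0)"
      unfolding I_def
    proof (rule abs_integral_le_bound[OF cp[OF d]])
      fix \<phi>
      have "\<bar>(\<Phi> (cos \<phi>) - P (cos \<phi>)) * (sin \<phi> * sin (real n * \<phi>))\<bar> \<le> e * (1 * 1)"
        unfolding abs_mult
        by (intro mult_mono abs_sin_le_one less_imp_le[OF e] cos_in abs_ge_zero zero_le_one
            mult_nonneg_nonneg less_imp_le[OF \<open>0 < e\<close>])
      then show "\<bar>(\<Phi> (cos \<phi>) - P (cos \<phi>)) * (sin \<phi> * sin (real n * \<phi>))\<bar> \<le> e" by simp
    qed simp
    moreover have "I (\<lambda>x. \<Phi> x - P x) = I \<Phi> - I P"
      unfolding I_def left_diff_distrib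
      by (intro Henstock_Kurzweil_Integration.integral_diff integrable_continuous_real cp \<Phi> contP)
    ultimately have "\<bar>E \<Phi> - E P\<bar> \<le> e * real n" and I: "\<bar>I \<Phi> - I P\<bar> \<le> e * pi" by simp_all
    have "\<bar>C * (I \<Phi> - I P)\<bar> \<le> 2 / pi * (e * pi)"
      unfolding abs_mult using I Cle by (intro mult_mono) auto
    then have "\<bar>C * I \<Phi> - C * I P\<bar> \<le> e * 2" by (simp add: right_diff_distrib mult_ac)
    with \<open>\<bar>E \<Phi> - E P\<bar> \<le> e * real n\<close> poly[OF P] show ?thesis by (simp add: distrib_left)
  qed
  have "\<bar>E \<Phi> - C * I \<Phi>\<bar> \<le> 0"
  proof (rule field_le_epsilon)
    fix e :: real assume "0 < e"
    then show "\<bar>E \<Phi> - C * I \<Phi>\<bar> \<le> 0 + e" using close[of "e / (real n + 2)"] by simp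
  qed
  then have "E \<Phi> = C * I \<Phi>" unfolding abs_le_zero_iff right_minus_eq .
  then show ?thesis unfolding E_def I_def C_def .
qed

end

section \<open>Central functions and their partial sums\<close>

lemma central_eq_diagonal:
  assumes f: "central f" and x: "x \<in> SU2" and \<theta>: "cos \<theta> = Re (x $ 1 $ 1)"
  shows "f x = f (su2 (cis \<theta>) 0)"
proof -
  obtain p q where xpq: "x = su2 p q" and pq: "(cmod p)\<^sup>2 + (cmod q)\<^sup>2 = 1"
    using x by (rule SU2_cases)
  have D: "su2 (cis \<theta>) 0 \<in> SU2" by (simp add: su2_in_SU2_iff)
  have c: "cos \<theta> = Re p" using \<theta> by (simp add: xpq)
  have conj: "f (u ** z ** ctrans u) = f z" if "u \<in> SU2" "z \<in> SU2" for u z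
    using f that by (simp add: central_def)
  show ?thesis
  proof (cases "q = 0")
    case True
    then have "(Im p)\<^sup>2 = (sin \<theta>)\<^sup>2" using pq c by (simp add: cmod_power2 sin_squared_eq)
    then consider "Im p = sin \<theta>" | "Im p = - sin \<theta>" by (auto simp: power2_eq_iff)
    then show ?thesis
    proof cases
      case 1
      then have "p = cis \<theta>" by (simp add: complex_eq_iff c)
      then show ?thesis by (simp add: xpq True)
    next
      case 2
      then have "p = cnj (cis \<theta>)" by (simp add: complex_eq_iff c)
      \<comment> \<open>Conjugation by \<open>su2 0 1\<close> swaps the two diagonal
        entries.\<close>
      then have "x = su2 0 1 ** su2 (cis \<theta>) 0 ** ctrans (su2 0 1)"
        by (simp add: xpq True ctrans_su2 su2_mult)
      then show ?thesis using conj[OF _ D, of "su2 0 1"] by (simp add: su2_in_SU2_iff)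
    qed
  next
    case False
    define l where "l = cis \<theta>"
    \<comment> \<open>The characteristic equation of \<open>x\<close> at \<open>l\<close>, whose
      trace and determinant are l + cnj l and l * cnj l.\<close>
    have l: "(l - p) * (l - cnj p) + q * cnj q = 0"
    proof -
      have "p * cnj p + q * cnj q = l * cnj l"
        unfolding complex_norm_square[symmetric] of_real_add[symmetric] using pq by (simp add: l_def)
      moreover have "p + cnj p = l + cnj l"
        unfolding complex_add_cnj by (simp add: l_def c)
      ultimately show ?thesis by algebra
    qed
    define r where "r = sqrt ((cmod q)\<^sup>2 + (cmod (l - p))\<^sup>2)"
    have r: "r > 0" using False by (auto simp: r_def intro!: add_pos_nonneg)
    \<comment> \<open>The first column (q, l - p) / r is a unit eigenvector of \<open>x\<close> for
      \<open>l\<close>; the quaternion form then dictates the second column, an eigenvector for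
      \<open>cnj l\<close>.\<close>
    define u where "u = su2 (q / r) (- cnj (l - p) / r)"
    have "cmod (- cnj (l - p) / r) = cmod (l - p) / r" "cmod (q / r) = cmod q / r"
      unfolding norm_divide norm_minus_cancel complex_mod_cnj using r by simp_all
    then have "(cmod (q / r))\<^sup>2 + (cmod (- cnj (l - p) / r))\<^sup>2 = ((cmod q)\<^sup>2 + (cmod (l - p))\<^sup>2) / r\<^sup>2"
      by (simp only: power_divide add_divide_distrib)
    also have "(cmod q)\<^sup>2 + (cmod (l - p))\<^sup>2 = r\<^sup>2" by (simp add: r_def)
    finally have u: "u \<in> SU2" using r by (simp add: u_def su2_in_SU2_iff)
    have l': "cnj l * cnj (l - p) = p * cnj (l - p) - q * cnj q"
    proof -
      have "cnj ((l - p) * (l - cnj p) + q * cnj q) = 0" by (simp add: l)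
      then show ?thesis by (simp add: algebra_simps)
    qed
    have "x ** u = u ** su2 l 0"
    proof -
      have "p * (q / r) - q * cnj (- cnj (l - p) / r) = q / r * l"
        using r by (simp add: field_simps)
      moreover have "p * (- cnj (l - p) / r) + q * cnj (q / r) = (- cnj (l - p) / r) * cnj l"
        using r l' by (simp add: field_simps)
      ultimately show ?thesis by (simp add: xpq u_def su2_mult)
    qed
    moreover have "u ** ctrans u = mat 1" using u by (simp add: SU2_def)
    then have "x = x ** u ** ctrans u"
      by (simp only: matrix_mul_assoc[symmetric] matrix_mul_rid)
    ultimately have "x = u ** su2 l 0 ** ctrans u" by simp
    then show ?thesis using conj[OF u D] by (simp add: l_def)
  qed
qed

text \<open>Left invariance alone moves \<open>x\<close> from \<open>f\<close> to the kernel: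
  replacing y by x y turns the argument of \<open>f\<close> into x y^{-1} x^{-1}, centrality removes
  the conjugation, and y^{-1} has the same half trace as y. The weight n + 1 in \<open>DN\<close>
  cancels the 1 / n of \<open>integral_continuous_cheb_u\<close>, taken at
  \<open>Suc n\<close>.\<close>

lemma SN_eq_sum_cheb_u:
  assumes haar: "haar_SU2 \<mu>" and f: "central f" and x: "x \<in> SU2"
    and cont: "continuous_on UNIV (\<lambda>\<theta>. f (su2 (cis \<theta>) 0))"
  shows "SN \<mu> N f x = (\<Sum>n\<le>N. 2 / pi * integral {0..pi} (\<lambda>\<phi>. f (su2 (cis \<phi>) 0) * (sin \<phi> * sin (real (Suc n) * \<phi>)))
     * cheb_u (Suc n) (Re (x $ 1 $ 1)))"
proof -
  define F where "F \<theta> = f (su2 (cis \<theta>) 0)" for \<theta>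
  define \<Phi> where "\<Phi> s = F (arccos s)" for s
  have Re_in: "Re (y $ 1 $ 1) \<in> {-1..1}" if "y \<in> SU2" for y
    using abs_Re_SU2_le[OF that] by (simp add: abs_le_iff)
  have \<Phi>: "continuous_on {-1..1} \<Phi>"
    unfolding \<Phi>_def F_def by (rule continuous_on_compose2[OF cont]) (auto intro!: continuous_on_arccos')
  have f\<Phi>: "f y = \<Phi> (Re (y $ 1 $ 1))" if "y \<in> SU2" for y
    unfolding \<Phi>_def F_def by (rule central_eq_diagonal[OF f that]) (use Re_in[OF that] in simp)
  obtain p q where xpq: "x = su2 p q" and pq: "(cmod p)\<^sup>2 + (cmod q)\<^sup>2 = 1"
    using x by (rule SU2_cases)
  define k where "k y = \<Phi> (Re ((x ** ctrans y) $ 1 $ 1)) * (\<Sum>n\<le>N. real (n + 1) * cheb_u (Suc n) (Re (y $ 1 $ 1)))" for y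
  have cs: "continuous_on SU2 (\<lambda>y :: cmat2. Re (y $ 1 $ 1))" by (intro continuous_intros)
  have contk: "continuous_on SU2 k"
  proof -
    have "continuous_on SU2 (\<lambda>y. \<Phi> (Re ((x ** ctrans y) $ 1 $ 1)))"
    proof (rule continuous_on_compose2[OF \<Phi>])
      show "continuous_on SU2 (\<lambda>y. Re ((x ** ctrans y) $ 1 $ 1))"
        unfolding cmat2_mult_nth ctrans_nth by (intro continuous_intros)
    qed (use Re_in SU2_mult[OF x ctrans_SU2] in blast)
    then show ?thesis unfolding k_def
      by (intro continuous_on_mult continuous_on_sum continuous_on_const continuous_on_cheb_u cs)
  qed
  have "SN \<mu> N f x = (\<integral>y. k y \<partial>\<mu>)"
    unfolding SN_def
  proof (rule Bochner_Integration.integral_cong[OF refl])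
    fix y assume "y \<in> space \<mu>"
    then have y: "y \<in> SU2" by (simp add: space_haar[OF haar])
    then show "f (x ** ctrans y) * DN N y = k y"
      unfolding k_def DN_def using f\<Phi>[OF SU2_mult[OF x ctrans_SU2[OF y]]]
      by (simp add: chi_eq_cheb_u del: cheb_u.simps)
  qed
  also have "\<dots> = (\<integral>y. k (x ** y) \<partial>\<mu>)"
    by (rule integral_haar_left[OF haar x contk, symmetric])
  also have "\<dots> = (\<integral>y. (\<Sum>n\<le>N. real (n + 1) * (\<Phi> (Re (y $ 1 $ 1)) * cheb_u (Suc n) (su2_lin p q y))) \<partial>\<mu>)"
  proof (rule Bochner_Integration.integral_cong[OF refl])
    fix y assume "y \<in> space \<mu>"
    then have y: "y \<in> SU2" by (simp add: space_haar[OF haar])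
    have "x ** ctrans (x ** y) = x ** ctrans y ** ctrans x"
      by (simp add: ctrans_mult matrix_mul_assoc)
    then have "\<Phi> (Re ((x ** ctrans (x ** y)) $ 1 $ 1)) = f (x ** ctrans y ** ctrans x)"
      using x y by (simp add: f\<Phi> SU2_mult ctrans_SU2)
    also have "\<dots> = f (ctrans y)"
      using f x ctrans_SU2[OF y] by (simp add: central_def)
    also have "\<dots> = \<Phi> (Re (y $ 1 $ 1))"
      using y by (simp add: f\<Phi> ctrans_SU2)
    finally show "k (x ** y) = (\<Sum>n\<le>N. real (n + 1) * (\<Phi> (Re (y $ 1 $ 1)) * cheb_u (Suc n) (su2_lin p q y)))"
      by (simp add: k_def xpq cmat2_mult_nth su2_lin_def sum_distrib_left mult_ac del: cheb_u.simps)
  qed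
  also have "\<dots> = (\<Sum>n\<le>N. (\<integral>y. real (n + 1) * (\<Phi> (Re (y $ 1 $ 1)) * cheb_u (Suc n) (su2_lin p q y)) \<partial>\<mu>))"
    by (intro Bochner_Integration.integral_sum integrable_haar[OF haar] continuous_on_mult continuous_on_const
        continuous_on_cheb_u continuous_on_su2_lin continuous_on_compose2[OF \<Phi> cs])
      (use Re_in in auto)
  also have "\<dots> = (\<Sum>n\<le>N. 2 / pi * integral {0..pi} (\<lambda>\<phi>. F \<phi> * (sin \<phi> * sin (real (Suc n) * \<phi>))) * cheb_u (Suc n) (Re p))"
  proof (rule sum.cong[OF refl])
    fix n
    have "integral {0..pi} (\<lambda>\<phi>. \<Phi> (cos \<phi>) * (sin \<phi> * sin (real (Suc n) * \<phi>))) =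
      integral {0..pi} (\<lambda>\<phi>. F \<phi> * (sin \<phi> * sin (real (Suc n) * \<phi>)))"
      by (rule integral_cong) (simp add: \<Phi>_def arccos_cos)
    then show "(\<integral>y. real (n + 1) * (\<Phi> (Re (y $ 1 $ 1)) * cheb_u (Suc n) (su2_lin p q y)) \<partial>\<mu>) =
      2 / pi * integral {0..pi} (\<lambda>\<phi>. F \<phi> * (sin \<phi> * sin (real (Suc n) * \<phi>))) * cheb_u (Suc n) (Re p)"
      using integral_continuous_cheb_u[OF haar pq _ \<Phi>, of "Suc n"]
      by (simp add: divide_simps mult_ac del: cheb_u.simps of_nat_Suc)
  qed
  finally show ?thesis by (simp add: xpq F_def del: cheb_u.simps)
qed

section \<open>Convergence of the partial sums\<close>

lemma sin_coeff_eq_cos_coeff: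
  assumes "continuous_on UNIV F"
  shows "2 / pi * integral {0..pi} (\<lambda>\<phi>. F \<phi> * (sin \<phi> * sin (real (Suc n) * \<phi>))) = cos_coeff F n - cos_coeff F (n + 2)"
proof -
  have c: "continuous_on S F" for S using assms continuous_on_subset by blast
  have *: "cos (real n * \<phi>) - cos (real (n + 2) * \<phi>) = 2 * (sin \<phi> * sin (real (Suc n) * \<phi>))" for \<phi>
  proof -
    have "real n * \<phi> = real (Suc n) * \<phi> - \<phi>" "real (n + 2) * \<phi> = real (Suc n) * \<phi> + \<phi>"
      by (simp_all add: algebra_simps)
    then show ?thesis by (simp only: cos_add cos_diff) simp
  qed
  have "cos_coeff F n - cos_coeff F (n + 2) = integral {0..pi} (\<lambda>t. F t * cos (real n * t) - F t * cos (real (n + 2) * t)) / pi"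
    unfolding cos_coeff_def
    by (subst Henstock_Kurzweil_Integration.integral_diff)
      (auto intro!: integrable_continuous_real continuous_intros c simp: diff_divide_distrib)
  also have "\<dots> = integral {0..pi} (\<lambda>t. 2 * (F t * (sin t * sin (real (Suc n) * t)))) / pi"
    unfolding right_diff_distrib[symmetric] * by (simp add: mult_ac)
  finally show ?thesis by simp
qed

lemma sum_cheb_u_eq:
  "(\<Sum>n\<le>N. (a n - a (n + 2)) * cheb_u (Suc n) (cos t)) = a 0 + 2 * (\<Sum>n=1..N. a n * cos (real n * t))
    - a (N + 1) * cheb_u N (cos t) - a (N + 2) * cheb_u (N + 1) (cos t)"
proof (induction N)
  case (Suc N)
  have "cheb_u (Suc (Suc N)) (cos t) = cheb_u N (cos t) + 2 * cos (real (Suc N) * t)"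
    using cheb_u_minus_cheb_u[of N "cos t"] by (simp add: cheb_t_cos del: cheb_u.simps of_nat_Suc)
  with Suc show ?case by (simp add: algebra_simps del: cheb_u.simps of_nat_Suc)
qed simp

lemma SN_eq_cos_sum:
  assumes haar: "haar_SU2 \<mu>" and f: "central f" and x: "x \<in> SU2"
    and F: "F = (\<lambda>\<theta>. f (su2 (cis \<theta>) 0))" and cont: "continuous_on UNIV F" and t: "cos t = Re (x $ 1 $ 1)"
  shows "SN \<mu> N f x = cos_sum F N t - cos_coeff F (N + 1) * cheb_u N (cos t)
    - cos_coeff F (N + 2) * cheb_u (N + 1) (cos t)"
proof -
  have "SN \<mu> N f x = (\<Sum>n\<le>N. 2 / pi * integral {0..pi} (\<lambda>\<phi>. F \<phi> * (sin \<phi> * sin (real (Suc n) * \<phi>)))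
     * cheb_u (Suc n) (cos t))"
    unfolding t F by (rule SN_eq_sum_cheb_u[OF haar f x cont[unfolded F]])
  also have "\<dots> = (\<Sum>n\<le>N. (cos_coeff F n - cos_coeff F (n + 2)) * cheb_u (Suc n) (cos t))"
    by (simp only: sin_coeff_eq_cos_coeff[OF cont])
  also have "\<dots> = cos_sum F N t - cos_coeff F (N + 1) * cheb_u N (cos t)
    - cos_coeff F (N + 2) * cheb_u (N + 1) (cos t)"
    unfolding cos_sum_def by (rule sum_cheb_u_eq)
  finally show ?thesis .
qed

text \<open>A nonzero limit would make \<open>w\<close>, up to sign, dominate a multiple of the
  harmonic series.\<close>

lemma summable_times_harmonic_limit:
  fixes w :: "nat \<Rightarrow> real"
  assumes "summable w" "(\<lambda>n. real (n + 1) * w n) \<longlonglongrightarrow> L"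
  shows "L = 0"
proof -
  have *: "\<not> 0 < L" if w: "summable w" "(\<lambda>n. real (n + 1) * w n) \<longlonglongrightarrow> L" for L and w :: "nat \<Rightarrow> real"
  proof
    assume "0 < L"
    have "\<forall>\<^sub>F n in sequentially. L / 2 < real (n + 1) * w n"
      using w(2) \<open>0 < L\<close> by (intro order_tendstoD) auto
    then have "\<forall>\<^sub>F n in sequentially. norm (L / 2 * inverse (real (Suc n))) \<le> w n"
      by eventually_elim (use \<open>0 < L\<close> in \<open>simp add: field_simps\<close>)
    then have "summable (\<lambda>n. L / 2 * inverse (real (Suc n)))"
      using w(1) by (rule summable_comparison_test_ev)
    then have "summable (\<lambda>n. inverse (real (Suc n)))"
      using \<open>0 < L\<close> by (subst (asm) summable_cmult_iff) auto
    then show False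
      using not_summable_harmonic[where 'a = real] by (subst (asm) summable_Suc_iff) simp
  qed
  have "\<not> 0 < - L"
    using *[of "\<lambda>n. - w n" "- L"] assms tendsto_minus[OF assms(2)] by (simp add: summable_minus)
  with *[OF assms] show ?thesis by linarith
qed

text \<open>The hypotheses force \<open>(n + 1) a (n + 2)\<close> to approach \<open>(A + (-1)^n B) / 2\<close>; summability of
  \<open>a n\<close> and of \<open>(-1)^n a n\<close> then excludes \<open>A \<noteq> 0\<close> and \<open>B \<noteq> 0\<close>, since the harmonic series diverges.\<close>

lemma coefficient_limit_zero:
  fixes a :: "nat \<Rightarrow> real"
  assumes sum: "summable a" "summable (\<lambda>n. (- 1) ^ n * a n)"
    and A: "(\<lambda>N. real N * a (N + 1) + real (N + 1) * a (N + 2)) \<longlonglongrightarrow> A"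
    and B: "(\<lambda>N. (- 1) ^ N * (real (N + 1) * a (N + 2) - real N * a (N + 1))) \<longlonglongrightarrow> B"
  shows "(\<lambda>n. real (n + 1) * a (n + 2)) \<longlonglongrightarrow> 0"
proof -
  define u where "u n = real (n + 1) * a (n + 2)" for n
  have sgn_null: "(\<lambda>n. (- 1) ^ n * z n) \<longlonglongrightarrow> 0" if "z \<longlonglongrightarrow> 0" for z :: "nat \<Rightarrow> real"
    using that by (subst tendsto_norm_zero_iff[symmetric]) (simp add: abs_mult power_abs tendsto_rabs_zero)
  have sgn2: "(- 1) ^ n * ((- 1) ^ n * z) = z" for n and z :: real
    by (simp add: mult.assoc[symmetric] power_mult_distrib[symmetric])
  have cancel: "real (n + 1) * (c * (z / real (n + 1))) = c * z" for n and c z :: real by simp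
  \<comment> \<open>Undoing the sign in hypothesis \<open>B\<close> and averaging with hypothesis
    \<open>A\<close> cancels \<open>real n * a (n + 1)\<close> and isolates
    \<open>u n\<close>.\<close>
  have D: "(\<lambda>n. u n - A / 2 - (- 1) ^ n * (B / 2)) \<longlonglongrightarrow> 0"
  proof -
    have "(\<lambda>n. ((real n * a (n + 1) + u n) - A) + (- 1) ^ n * ((- 1) ^ n * (u n - real n * a (n + 1)) - B)) \<longlonglongrightarrow> 0 + 0"
      using A B unfolding u_def by (intro tendsto_add sgn_null) (simp_all add: LIM_zero)
    then have 1: "(\<lambda>n. (((real n * a (n + 1) + u n) - A) + (- 1) ^ n * ((- 1) ^ n * (u n - real n * a (n + 1)) - B)) / 2) \<longlonglongrightarrow> 0 / 2"
      by (intro tendsto_divide) auto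
    have 2: "(((real n * a (n + 1) + u n) - A) + (- 1) ^ n * ((- 1) ^ n * (u n - real n * a (n + 1)) - B)) / 2
        = u n - A / 2 - (- 1) ^ n * (B / 2)" for n
      unfolding right_diff_distrib sgn2 by (simp add: field_simps)
    show ?thesis using 1 unfolding 2 by simp
  qed
  have alt: "summable (\<lambda>n. (- 1) ^ n / real (n + 1))"
  proof -
    have "(\<lambda>n. 1 / real (n + 1)) \<longlonglongrightarrow> 0" by real_asymp
    moreover have "monoseq (\<lambda>n. 1 / real (n + 1))"
      by (intro decseq_imp_monoseq) (auto simp: decseq_def intro!: divide_left_mono)
    ultimately have "summable (\<lambda>n. (- 1) ^ n * (1 / real (n + 1)))"
      by (rule summable_Leibniz(1))
    then show ?thesis by simp
  qed
  have shift: "summable (\<lambda>n. a (n + 2))" "summable (\<lambda>n. (- 1) ^ n * a (n + 2))"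
    using sum summable_iff_shift[of a 2] summable_iff_shift[of "\<lambda>n. (- 1) ^ n * a n" 2] by simp_all
  have "A / 2 = 0"
  proof (rule summable_times_harmonic_limit)
    \<comment> \<open>The oscillating part (-1)^n B / 2 of \<open>u n\<close> corresponds to an
      alternating harmonic term, summable by Leibniz; once it is subtracted, only A / 2 is left in
      the limit.\<close>
    show "summable (\<lambda>n. a (n + 2) - B / 2 * ((- 1) ^ n / real (n + 1)))"
      by (intro summable_diff summable_mult shift alt)
    have "(\<lambda>n. (u n - A / 2 - (- 1) ^ n * (B / 2)) + A / 2) \<longlonglongrightarrow> 0 + A / 2"
      by (intro tendsto_add D tendsto_const)
    moreover have "(u n - A / 2 - (- 1) ^ n * (B / 2)) + A / 2 = real (n + 1) * (a (n + 2) - B / 2 * ((- 1) ^ n / real (n + 1)))" for n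
      unfolding right_diff_distrib cancel by (simp add: u_def)
    ultimately show "(\<lambda>n. real (n + 1) * (a (n + 2) - B / 2 * ((- 1) ^ n / real (n + 1)))) \<longlonglongrightarrow> A / 2"
      by simp
  qed
  moreover have "B / 2 = 0"
  proof (rule summable_times_harmonic_limit)
    \<comment> \<open>Multiplication by (-1)^n exchanges the roles of A and B.\<close>
    show "summable (\<lambda>n. (- 1) ^ n * a (n + 2) - A / 2 * ((- 1) ^ n / real (n + 1)))"
      by (intro summable_diff summable_mult shift alt)
    have "(\<lambda>n. (- 1) ^ n * (u n - A / 2 - (- 1) ^ n * (B / 2)) + B / 2) \<longlonglongrightarrow> 0 + B / 2"
      by (intro tendsto_add sgn_null D tendsto_const)
    moreover have "(- 1) ^ n * (u n - A / 2 - (- 1) ^ n * (B / 2)) + B / 2 =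
       real (n + 1) * ((- 1) ^ n * a (n + 2) - A / 2 * ((- 1) ^ n / real (n + 1)))" for n
      unfolding right_diff_distrib sgn2 cancel by (simp add: u_def mult_ac)
    ultimately show "(\<lambda>n. real (n + 1) * ((- 1) ^ n * a (n + 2) - A / 2 * ((- 1) ^ n / real (n + 1)))) \<longlonglongrightarrow> B / 2"
      by simp
  qed
  ultimately show ?thesis using D by (simp add: u_def)
qed

section \<open>The metric on the diagonal and the two convergence statements\<close>

lemma cmod_cis_diff_le: "cmod (cis x - cis y) \<le> \<bar>x - y\<bar>"
proof -
  have "(cmod (cis x - cis y))\<^sup>2 = ((sin x)\<^sup>2 + (cos x)\<^sup>2) + ((sin y)\<^sup>2 + (cos y)\<^sup>2) - 2 * cos (x - y)"
    unfolding cmod_power2 by (simp add: cos_diff power2_eq_square algebra_simps del: sin_cos_squared_add sin_cos_squared_add2 sin_cos_squared_add3)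
  also have "\<dots> = 4 * (sin ((x - y) / 2))\<^sup>2"
  proof -
    have "2 * ((x - y) / 2) = x - y" by simp
    then have "cos (x - y) = 1 - 2 * (sin ((x - y) / 2))\<^sup>2"
      using cos_double_sin[of "(x - y) / 2"] by (simp only:)
    then show ?thesis by simp
  qed
  also have "\<dots> \<le> 4 * \<bar>(x - y) / 2\<bar>\<^sup>2"
    using abs_sin_x_le_abs_x[of "(x - y) / 2"] by (simp only: mult_le_cancel_left_pos zero_less_numeral abs_le_square_iff power2_abs)
  also have "\<dots> = \<bar>x - y\<bar>\<^sup>2" by (simp add: power_divide)
  finally show ?thesis by (rule power2_le_imp_le) simp
qed

text \<open>The factor 1/2 in \<open>su2_dist\<close> cancels the two equal diagonal entries in the
  trace. On diagonal matrices the distance is therefore the chord of the unit circle, which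
  \<open>cmod_cis_diff_le\<close> bounds by the arc.\<close>

lemma su2_dist_su2: "su2_dist (su2 p q) (su2 r s) = sqrt ((cmod (p - r))\<^sup>2 + (cmod (q - s))\<^sup>2)"
proof -
  define N where "N = (cmod (p - r))\<^sup>2 + (cmod (q - s))\<^sup>2"
  have N: "complex_of_real N = (p - r) * cnj (p - r) + (q - s) * cnj (q - s)"
    unfolding N_def of_real_add complex_norm_square by simp
  have "su2 p q - su2 r s = su2 (p - r) (q - s)" by (simp add: cmat2_eq_iff)
  moreover have "su2 (p - r) (q - s) ** ctrans (su2 (p - r) (q - s)) = su2 (complex_of_real N) 0"
    unfolding ctrans_su2 su2_mult N by (simp add: cmat2_eq_iff algebra_simps)
  ultimately have "Re (trace ((su2 p q - su2 r s) ** ctrans (su2 p q - su2 r s))) = 2 * N"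
    by (simp add: trace_def sum_2)
  then show ?thesis unfolding su2_dist_def N_def by simp
qed

lemma sum_eq_cos_sum: "(\<Sum>n\<le>N. cos_coeff F n * cos (real n * t)) = (cos_sum F N t + cos_coeff F 0) / 2"
  by (induction N) (simp_all add: cos_sum_def field_simps)

lemma summable_cos_coeff:
  assumes "(\<lambda>N. cos_sum F N t) \<longlonglongrightarrow> L"
  shows "summable (\<lambda>n. cos_coeff F n * cos (real n * t))"
proof -
  have "(\<lambda>N. (cos_sum F N t + cos_coeff F 0) / 2) \<longlonglongrightarrow> (L + cos_coeff F 0) / 2"
    by (intro tendsto_intros assms) simp
  then show ?thesis
    unfolding sum_eq_cos_sum[symmetric] summable_iff_convergent' by (rule convergentI)
qed

lemma uniform_limit_minus_null:
  fixes g h :: "nat \<Rightarrow> 'a \<Rightarrow> real"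
  assumes "uniform_limit S g f sequentially"
    and b: "b \<longlonglongrightarrow> 0" and le: "\<And>N x. x \<in> S \<Longrightarrow> \<bar>h N x\<bar> \<le> b N"
  shows "uniform_limit S (\<lambda>N x. g N x - h N x) f sequentially"
proof (rule uniform_limitI)
  fix e :: real assume "0 < e"
  then have "\<forall>\<^sub>F N in sequentially. b N < e / 2" using b by (intro order_tendstoD) auto
  moreover have "\<forall>\<^sub>F N in sequentially. \<forall>x\<in>S. dist (g N x) (f x) < e / 2"
    using \<open>0 < e\<close> by (intro uniform_limitD[OF assms(1)]) simp
  ultimately show "\<forall>\<^sub>F N in sequentially. \<forall>x\<in>S. dist (g N x - h N x) (f x) < e"
  proof eventually_elim
    case (elim N)
    show ?case
    proof
      fix x assume "x \<in> S"
      then have "dist (g N x) (f x) < e / 2" "\<bar>h N x\<bar> \<le> b N" using elim le by auto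
      then show "dist (g N x - h N x) (f x) < e"
        using elim(1) unfolding dist_real_def by linarith
    qed
  qed
qed

theorem theorem2:
  fixes f :: "cmat2 \<Rightarrow> real" and \<alpha> :: real and \<mu> :: "cmat2 measure"
  assumes "haar_SU2 \<mu>"
    and "0 < \<alpha>" and "\<alpha> < 1"
    and "f \<in> Lip \<alpha>"
    and "central f"
  shows "(\<forall>U. openin (top_of_set SU2) U \<and> mat 1 \<in> U \<and> - mat 1 \<in> U \<longrightarrow>
            uniform_limit (SU2 - U) (\<lambda>N x. SN \<mu> N f x) f sequentially)
     \<and> (convergent (\<lambda>N. SN \<mu> N f (mat 1)) \<and> convergent (\<lambda>N. SN \<mu> N f (- mat 1)) \<longrightarrow>
            uniform_limit SU2 (\<lambda>N x. SN \<mu> N f x) f sequentially)"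
proof -
  obtain M where M: "0 \<le> M" and lip: "\<And>x y. x \<in> SU2 \<Longrightarrow> y \<in> SU2 \<Longrightarrow> \<bar>f x - f y\<bar> \<le> M * su2_dist x y powr \<alpha>"
    using assms(4) unfolding Lip_def by blast
  define F where "F = (\<lambda>\<theta>. f (su2 (cis \<theta>) 0))"
  have D: "su2 (cis \<theta>) 0 \<in> SU2" for \<theta> by (simp add: su2_in_SU2_iff)
  have holder: "\<bar>F x - F y\<bar> \<le> M * \<bar>x - y\<bar> powr \<alpha>" for x y
  proof -
    have "\<bar>F x - F y\<bar> \<le> M * cmod (cis x - cis y) powr \<alpha>"
      using lip[OF D D, of x y] by (simp add: F_def su2_dist_su2)
    also have "\<dots> \<le> M * \<bar>x - y\<bar> powr \<alpha>"
      using M assms(2) by (intro mult_left_mono powr_mono2 cmod_cis_diff_le) auto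
    finally show ?thesis .
  qed
  have diag: "f x = F \<theta>" if "x \<in> SU2" "cos \<theta> = Re (x $ 1 $ 1)" for x \<theta>
    unfolding F_def by (rule central_eq_diagonal[OF assms(5) that])
  have even: "F (- \<theta>) = F \<theta>" for \<theta>
    using diag[OF D, of \<theta> "- \<theta>"] by (simp add: F_def)
  have per: "F (\<theta> + 2 * pi) = F \<theta>" for \<theta>
    by (simp add: F_def cis_mult[symmetric])
  have contF: "continuous_on UNIV F" by (rule continuous_on_holder[OF assms(2) holder])
  have UL: "uniform_limit UNIV (cos_sum F) F sequentially"
    by (rule uniform_limit_cos_sum[OF assms(2) holder even per])
  have lim: "(\<lambda>N. cos_sum F N \<theta>) \<longlonglongrightarrow> F \<theta>" for \<theta>
    using tendsto_uniform_limitI[OF UL] by simp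
  define a where "a = cos_coeff F"
  define t where "t x = arccos (Re (x $ 1 $ 1))" for x :: cmat2
  have t: "cos (t x) = Re (x $ 1 $ 1)" if "x \<in> SU2" for x
    using abs_Re_SU2_le[OF that] by (simp add: t_def)
  have SN: "SN \<mu> N f x = cos_sum F N \<theta> - (a (N + 1) * cheb_u N (cos \<theta>) + a (N + 2) * cheb_u (N + 1) (cos \<theta>))"
    if "x \<in> SU2" "cos \<theta> = Re (x $ 1 $ 1)" for x N \<theta>
    using SN_eq_cos_sum[OF assms(1,5) that(1) F_def contF that(2), of N] by (simp add: a_def)
  \<comment> \<open>Both statements reduce to dominating the two boundary terms on \<open>S\<close>
    by a null sequence.\<close>
  have criterion: "uniform_limit S (\<lambda>N x. SN \<mu> N f x) f sequentially"
    if S: "S \<subseteq> SU2" and b: "b \<longlonglongrightarrow> 0"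
      and le: "\<And>N x. x \<in> S \<Longrightarrow> \<bar>a (N + 1)\<bar> * \<bar>cheb_u N (cos (t x))\<bar> + \<bar>a (N + 2)\<bar> * \<bar>cheb_u (N + 1) (cos (t x))\<bar> \<le> b N"
    for S b
  proof -
    have "uniform_limit S (\<lambda>N x. cos_sum F N (t x)) f sequentially"
    proof (rule uniform_limitI)
      fix e :: real assume "0 < e"
      show "\<forall>\<^sub>F N in sequentially. \<forall>x\<in>S. dist (cos_sum F N (t x)) (f x) < e"
        using uniform_limitD[OF UL \<open>0 < e\<close>]
      proof eventually_elim
        case (elim N)
        show ?case
        proof
          fix x assume "x \<in> S"
          then have "f x = F (t x)" using S t by (intro diag) auto
          then show "dist (cos_sum F N (t x)) (f x) < e" using elim by simp
        qed
      qed
    qed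
    then have lim_S: "uniform_limit S (\<lambda>N x. cos_sum F N (t x) -
        (a (N + 1) * cheb_u N (cos (t x)) + a (N + 2) * cheb_u (N + 1) (cos (t x)))) f sequentially"
    proof (rule uniform_limit_minus_null[OF _ b])
      fix N x assume "x \<in> S"
      have "\<bar>a (N + 1) * cheb_u N (cos (t x)) + a (N + 2) * cheb_u (N + 1) (cos (t x))\<bar>
        \<le> \<bar>a (N + 1) * cheb_u N (cos (t x))\<bar> + \<bar>a (N + 2) * cheb_u (N + 1) (cos (t x))\<bar>"
        by (rule abs_triangle_ineq)
      also have "\<dots> \<le> b N" using le[OF \<open>x \<in> S\<close>, of N] by (simp only: abs_mult)
      finally show "\<bar>a (N + 1) * cheb_u N (cos (t x)) + a (N + 2) * cheb_u (N + 1) (cos (t x))\<bar> \<le> b N" .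
    qed
    have SN_S: "SN \<mu> N f x = cos_sum F N (t x) -
        (a (N + 1) * cheb_u N (cos (t x)) + a (N + 2) * cheb_u (N + 1) (cos (t x)))" if "x \<in> S" for N x
      using that S t by (intro SN) auto
    show ?thesis
      by (rule uniform_limit_cong'[THEN iffD2, OF SN_S refl lim_S])
  qed
  have sum: "summable (\<lambda>n. a n * cos (real n * \<theta>))" for \<theta>
    unfolding a_def by (rule summable_cos_coeff[OF lim])
  \<comment> \<open>At angle 0 the cosine series is the series of \<open>a\<close>, so its
    convergence already makes the coefficients tend to 0.\<close>
  have a0: "a \<longlonglongrightarrow> 0" using summable_LIMSEQ_zero[OF sum[of 0]] by simp
  have a1: "(\<lambda>N. a (N + k)) \<longlonglongrightarrow> 0" for k by (rule LIMSEQ_ignore_initial_segment[OF a0])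
  show ?thesis
  proof (intro conjI allI impI; elim conjE)
    fix U assume U: "openin (top_of_set SU2) U" "mat 1 \<in> U" "- mat 1 \<in> U"
    have "closedin (top_of_set SU2) (SU2 - U)"
      using U(1) by (simp add: openin_closedin_eq closedin_diff)
    then have cpt: "compact (SU2 - U)" using compact_SU2 closedin_compact by blast
    \<comment> \<open>\<open>c\<close> is the minimum of sin^2 = 1 - (Re x11)^2 on the compact
      complement, positive because a vanishing sine forces x = \<plusminus>e; for an empty
      complement any positive value serves.\<close>
    obtain c where c: "0 < c" "\<And>x. x \<in> SU2 - U \<Longrightarrow> c \<le> (sin (t x))\<^sup>2"
    proof (cases "SU2 - U = {}")
      case True
      then show thesis using that[of 1] by auto
    next
      case False
      have "continuous_on (SU2 - U) (\<lambda>x. 1 - (Re (x $ 1 $ 1))\<^sup>2)" by (intro continuous_intros)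
      then obtain z where z: "z \<in> SU2 - U" "\<And>x. x \<in> SU2 - U \<Longrightarrow> 1 - (Re (z $ 1 $ 1))\<^sup>2 \<le> 1 - (Re (x $ 1 $ 1))\<^sup>2"
        using continuous_attains_inf[OF cpt False] by blast
      obtain p q where pq: "z = su2 p q" "(cmod p)\<^sup>2 + (cmod q)\<^sup>2 = 1" using z by (metis DiffD1 SU2_cases)
      have "1 - (Re p)\<^sup>2 = (Im p)\<^sup>2 + (cmod q)\<^sup>2" using pq(2) by (simp add: cmod_power2)
      moreover have "(Im p)\<^sup>2 + (cmod q)\<^sup>2 \<noteq> 0"
      proof
        assume 0: "(Im p)\<^sup>2 + (cmod q)\<^sup>2 = 0"
        then have "q = 0" "Im p = 0" by (auto simp: add_nonneg_eq_0_iff)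
        moreover from this have "Re p = 1 \<or> Re p = - 1" using pq(2) by (simp add: cmod_power2 power2_eq_1_iff)
        ultimately have "q = 0" "p = 1 \<or> p = - 1" by (auto simp: complex_eq_iff)
        then have "z = mat 1 \<or> z = - mat 1"
          by (auto simp: pq(1) mat_1_eq_su2 minus_su2)
        then show False using z U by auto
      qed
      ultimately have "0 < 1 - (Re (z $ 1 $ 1))\<^sup>2" by (simp add: pq(1) less_le)
      then show thesis using z(2) t
        by (intro that[of "1 - (Re (z $ 1 $ 1))\<^sup>2"]) (auto simp: sin_squared_eq)
    qed
    have cheb: "\<bar>cheb_u n (cos (t x))\<bar> \<le> 1 / sqrt c" if "x \<in> SU2 - U" for n x
    proof -
      have "sqrt c \<le> \<bar>sin (t x)\<bar>" using real_sqrt_le_mono[OF c(2)[OF that]] by simp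
      then have "\<bar>cheb_u n (cos (t x))\<bar> * sqrt c \<le> \<bar>cheb_u n (cos (t x))\<bar> * \<bar>sin (t x)\<bar>"
        by (intro mult_left_mono) auto
      also have "\<dots> = \<bar>sin (real n * t x)\<bar>" by (simp only: abs_mult[symmetric] cheb_u_cos)
      also have "\<dots> \<le> 1" by simp
      finally show ?thesis using c by (simp add: field_simps)
    qed
    show "uniform_limit (SU2 - U) (\<lambda>N x. SN \<mu> N f x) f sequentially"
    proof (rule criterion)
      show "(\<lambda>N. \<bar>a (N + 1)\<bar> * (1 / sqrt c) + \<bar>a (N + 2)\<bar> * (1 / sqrt c)) \<longlonglongrightarrow> 0"
        using a1[of 1] a1[of 2] by (intro tendsto_add_zero tendsto_mult_left_zero tendsto_rabs_zero)
      show "\<bar>a (N + 1)\<bar> * \<bar>cheb_u N (cos (t x))\<bar> + \<bar>a (N + 2)\<bar> * \<bar>cheb_u (N + 1) (cos (t x))\<bar>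
          \<le> \<bar>a (N + 1)\<bar> * (1 / sqrt c) + \<bar>a (N + 2)\<bar> * (1 / sqrt c)" if "x \<in> SU2 - U" for N x
        by (intro add_mono mult_left_mono cheb[OF that] abs_ge_zero)
    qed auto
  next
    assume conv: "convergent (\<lambda>N. SN \<mu> N f (mat 1))" "convergent (\<lambda>N. SN \<mu> N f (- mat 1))"
    have e: "mat 1 \<in> SU2" "- mat 1 \<in> SU2"
      by (simp_all add: mat_1_eq_su2 minus_su2 su2_in_SU2_iff)
    obtain A B where AB: "(\<lambda>N. SN \<mu> N f (mat 1)) \<longlonglongrightarrow> A" "(\<lambda>N. SN \<mu> N f (- mat 1)) \<longlonglongrightarrow> B"
      using conv by (auto simp: convergent_def)
    \<comment> \<open>At e the angle is 0 and \<open>cheb_u n 1\<close> is n. Since the cosine sums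
      converge, convergence of the partial sums at e is that of the boundary terms.\<close>
    have "cos_sum F N 0 - SN \<mu> N f (mat 1) = real N * a (N + 1) + real (N + 1) * a (N + 2)" for N
      using SN[OF e(1), of 0 N] cheb_u_1[of N] cheb_u_1[of "N + 1"]
      by (simp add: mat_2_nth algebra_simps del: cheb_u.simps)
    then have 1: "(\<lambda>N. real N * a (N + 1) + real (N + 1) * a (N + 2)) \<longlonglongrightarrow> F 0 - A"
      using tendsto_diff[OF lim[of 0] AB(1)] by simp
    \<comment> \<open>At -e the angle is pi, and the sign (-1)^(n+1) of
      \<open>cheb_u n (- 1)\<close> turns the sum of the boundary terms into an alternating
      difference.\<close>
    have "cos_sum F N pi - SN \<mu> N f (- mat 1) = (- 1) ^ N * (real (N + 1) * a (N + 2) - real N * a (N + 1))" for N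
      using SN[OF e(2), of pi N] cheb_u_1[of N] cheb_u_1[of "N + 1"] cheb_u_minus[of N 1] cheb_u_minus[of "N + 1" 1]
      by (simp add: mat_2_nth algebra_simps del: cheb_u.simps)
    then have 2: "(\<lambda>N. (- 1) ^ N * (real (N + 1) * a (N + 2) - real N * a (N + 1))) \<longlonglongrightarrow> F pi - B"
      using tendsto_diff[OF lim[of pi] AB(2)] by simp
    have "summable a" using sum[of 0] by simp
    moreover have "summable (\<lambda>n. (- 1) ^ n * a n)" using sum[of pi] by (simp add: mult.commute)
    ultimately have 3: "(\<lambda>n. real (n + 1) * a (n + 2)) \<longlonglongrightarrow> 0"
      using 1 2 by (rule coefficient_limit_zero)
    \<comment> \<open>The other boundary coefficient is the same null sequence shifted by one
      index.\<close>
    then have 4: "(\<lambda>n. real n * a (n + 1)) \<longlonglongrightarrow> 0"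
      by (intro LIMSEQ_imp_Suc[of "\<lambda>n. real n * a (n + 1)"]) simp
    show "uniform_limit SU2 (\<lambda>N x. SN \<mu> N f x) f sequentially"
    proof (rule criterion)
      show "(\<lambda>N. \<bar>real N * a (N + 1)\<bar> + \<bar>real (N + 1) * a (N + 2)\<bar>) \<longlonglongrightarrow> 0"
        by (intro tendsto_add_zero tendsto_rabs_zero 3 4)
      fix N and x :: cmat2
      have "\<bar>cheb_u n (cos (t x))\<bar> \<le> real n" for n by (rule abs_cheb_u_le) simp
      then have "\<bar>a (N + 1)\<bar> * \<bar>cheb_u N (cos (t x))\<bar> + \<bar>a (N + 2)\<bar> * \<bar>cheb_u (N + 1) (cos (t x))\<bar>
          \<le> \<bar>a (N + 1)\<bar> * real N + \<bar>a (N + 2)\<bar> * real (N + 1)"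
        by (intro add_mono mult_left_mono abs_ge_zero)
      also have "\<dots> = \<bar>real N * a (N + 1)\<bar> + \<bar>real (N + 1) * a (N + 2)\<bar>"
        by (simp only: abs_mult abs_of_nat mult.commute)
      finally show "\<bar>a (N + 1)\<bar> * \<bar>cheb_u N (cos (t x))\<bar> + \<bar>a (N + 2)\<bar> * \<bar>cheb_u (N + 1) (cos (t x))\<bar>
          \<le> \<bar>real N * a (N + 1)\<bar> + \<bar>real (N + 1) * a (N + 2)\<bar>" .
    qed auto
  qed
qed

end
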